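(* Let $A$ be a unital operator algebra in a von Neumann algebra $M$, and let $P : A \to A$ be a unital completely bicontractive projection. Let $D$ be the closed algebra generated by $P(A)$, and let $C = (I-P)(D)$. Suppose further that either $C\, P(A)^* \subset \overline{MC}^{w*}$, the weak* closed left ideal in $M$ generated by $C$ (this is equivalent to saying that the left support projection of $P(A)C^*$ is dominated by the right support projection of $C$); or, alternatively, that $P(A)^* C$ is contained in the weak* closed right ideal in $M$ generated by $C$ (or equivalently that the right support projection of $C^* P(A)$ is dominated by the left support projection of $C$). Then $P(A)$ is a subalgebra of $A$.
   Context: A unital operator algebra is a norm-closed, not necessarily selfadjoint, algebra of operators on a Hilbert space containing the identity operator, with its inherited operator space structure. A projection on $A$ is a linear idempotent map $P : A \to A$; it is unital if $P(1)=1$, and completely bicontractive if both $P$ and $I-P$ are completely contractive. For a subset $S$ of $M$, $S^* = \{s^* : s \in S\}$; the left (resp. right) support projection of $S$ is the supremum of the left (range) (resp. right) support projections of the elements of $S$. For subsets $S,T$ of $M$, $ST$ denotes the set of products $st$ or equivalently, for the present purposes, its linear span. *)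

theory Defs
  imports "HOL-Analysis.Analysis"
begin

(* The underlying real inner product is the real part of the complex one, so norm,
   positivity and definiteness are inherited from real_inner.  The form cinner is linear
   in its first argument. *)
class complex_hilbert = real_inner + complete_space +
  fixes scaleC :: "complex \<Rightarrow> 'a \<Rightarrow> 'a" (infixr "*\<^sub>C" 75)
    and cinner :: "'a \<Rightarrow> 'a \<Rightarrow> complex"
  assumes scaleC_add_right: "c *\<^sub>C (x + y) = c *\<^sub>C x + c *\<^sub>C y"
    and scaleC_add_left: "(b + c) *\<^sub>C x = b *\<^sub>C x + c *\<^sub>C x"
    and scaleC_scaleC: "b *\<^sub>C c *\<^sub>C x = (b * c) *\<^sub>C x"
    and scaleC_one: "1 *\<^sub>C x = x"
    and scaleR_scaleC: "r *\<^sub>R x = complex_of_real r *\<^sub>C x"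
    and cinner_commute: "cinner x y = cnj (cinner y x)"
    and cinner_add_left: "cinner (x + y) z = cinner x z + cinner y z"
    and cinner_scaleC_left: "cinner (c *\<^sub>C x) y = c * cinner x y"
    and inner_eq_Re_cinner: "inner x y = Re (cinner x y)"

instantiation complex :: complex_hilbert
begin

definition scaleC_complex :: "complex \<Rightarrow> complex \<Rightarrow> complex"
  where "scaleC_complex c x = c * x"

definition cinner_complex :: "complex \<Rightarrow> complex \<Rightarrow> complex"
  where "cinner_complex x y = x * cnj y"

instance
  by standard
    (auto simp: scaleC_complex_def cinner_complex_def inner_complex_def algebra_simps
      scaleR_conv_of_real)

end

lemma cinner_self_of_real: "cinner x x = complex_of_real ((norm x)\<^sup>2)"
proof -
  have "Im (cinner x x) = 0"
    using arg_cong[OF cinner_commute[of x x], of Im] by simp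
  then show ?thesis
    by (simp add: complex_eq_iff power2_norm_eq_inner inner_eq_Re_cinner)
qed

lemma norm_scaleC: "norm (c *\<^sub>C (x::'h::complex_hilbert)) = cmod c * norm x"
proof -
  have "complex_of_real ((norm (c *\<^sub>C x))\<^sup>2) = cinner (c *\<^sub>C x) (c *\<^sub>C x)"
    by (simp only: cinner_self_of_real)
  also have "\<dots> = c * cnj c * cinner x x"
    using cinner_commute[of x "c *\<^sub>C x"] cinner_commute[of x x]
    by (simp add: cinner_scaleC_left)
  also have "\<dots> = complex_of_real ((cmod c * norm x)\<^sup>2)"
    by (simp add: cinner_self_of_real complex_norm_square[symmetric] power_mult_distrib)
  finally have "(norm (c *\<^sub>C x))\<^sup>2 = (cmod c * norm x)\<^sup>2"
    using of_real_eq_iff by blast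
  then show ?thesis
    by (simp add: power2_eq_iff_nonneg)
qed

lemma bounded_linear_scaleC: "bounded_linear ((*\<^sub>C) c :: 'h::complex_hilbert \<Rightarrow> 'h)"
proof (rule bounded_linear_intro[where K = "cmod c"])
  show "c *\<^sub>C (r *\<^sub>R x) = r *\<^sub>R (c *\<^sub>C x)" for r and x :: 'h
    by (simp add: scaleR_scaleC scaleC_scaleC mult.commute)
qed (simp_all add: scaleC_add_right norm_scaleC mult.commute)


section \<open>Operator algebras\<close>

(* The type of bounded_linear operators only records real linearity. *)
definition B_ops :: "('h::complex_hilbert \<Rightarrow>\<^sub>L 'h) set"
  where "B_ops = {T. \<forall>c x. blinfun_apply T (c *\<^sub>C x) = c *\<^sub>C blinfun_apply T x}"

lift_definition op_scale :: "complex \<Rightarrow> ('h::complex_hilbert \<Rightarrow>\<^sub>L 'h) \<Rightarrow> ('h \<Rightarrow>\<^sub>L 'h)"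
  is "\<lambda>c T x. c *\<^sub>C T x"
  by (rule bounded_linear_compose[OF bounded_linear_scaleC])

global_interpretation op_vs: vector_space
  "op_scale :: complex \<Rightarrow> ('h::complex_hilbert \<Rightarrow>\<^sub>L 'h) \<Rightarrow> ('h \<Rightarrow>\<^sub>L 'h)"
  by standard
    (transfer, auto simp: scaleC_add_right scaleC_add_left scaleC_scaleC scaleC_one)+

definition is_adjoint :: "('h::complex_hilbert \<Rightarrow>\<^sub>L 'h) \<Rightarrow> ('h \<Rightarrow>\<^sub>L 'h) \<Rightarrow> bool"
  where "is_adjoint T S \<longleftrightarrow>
    (\<forall>x y. cinner (blinfun_apply T x) y = cinner x (blinfun_apply S y))"

definition op_star :: "('h::complex_hilbert \<Rightarrow>\<^sub>L 'h) set \<Rightarrow> ('h \<Rightarrow>\<^sub>L 'h) set"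
  where "op_star S = {t \<in> B_ops. \<exists>s\<in>S. is_adjoint s t}"

definition op_prod :: "('h::complex_hilbert \<Rightarrow>\<^sub>L 'h) set \<Rightarrow> ('h \<Rightarrow>\<^sub>L 'h) set \<Rightarrow> ('h \<Rightarrow>\<^sub>L 'h) set"
  where "op_prod S T = {s o\<^sub>L t | s t. s \<in> S \<and> t \<in> T}"

definition op_subalgebra :: "('h::complex_hilbert \<Rightarrow>\<^sub>L 'h) set \<Rightarrow> bool"
  where "op_subalgebra B \<longleftrightarrow> B \<subseteq> B_ops \<and> op_vs.subspace B \<and> op_prod B B \<subseteq> B"

definition unital_operator_algebra :: "('h::complex_hilbert \<Rightarrow>\<^sub>L 'h) set \<Rightarrow> bool"
  where "unital_operator_algebra A \<longleftrightarrow> op_subalgebra A \<and> id_blinfun \<in> A \<and> closed A"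

definition closed_algebra_generated ::
    "('h::complex_hilbert \<Rightarrow>\<^sub>L 'h) set \<Rightarrow> ('h \<Rightarrow>\<^sub>L 'h) set"
  where "closed_algebra_generated S = (\<lambda>B. op_subalgebra B \<and> closed B) hull S"


section \<open>The weak* topology and von Neumann algebras\<close>

(* The normal functionals, i.e. those in the predual of B(H). *)
definition normal_functionals :: "(('h::complex_hilbert \<Rightarrow>\<^sub>L 'h) \<Rightarrow> complex) set"
  where "normal_functionals =
    {(\<lambda>T. \<Sum>n. cinner (blinfun_apply T (x n)) (y n)) | x y :: nat \<Rightarrow> 'h.
       summable (\<lambda>n. (norm (x n))\<^sup>2) \<and> summable (\<lambda>n. (norm (y n))\<^sup>2)}"

(* The weak* topology of B(H).  The weak* topology of a von Neumann algebra acting on H is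
   the induced one, and weak* closedness in it agrees with closedness in B(H). *)
definition weakstar_topology :: "('h::complex_hilbert \<Rightarrow>\<^sub>L 'h) topology"
  where "weakstar_topology =
    topology_generated_by {{T \<in> B_ops. \<phi> T \<in> U} | \<phi> U. \<phi> \<in> normal_functionals \<and> open U}"

definition von_neumann_algebra :: "('h::complex_hilbert \<Rightarrow>\<^sub>L 'h) set \<Rightarrow> bool"
  where "von_neumann_algebra M \<longleftrightarrow>
    op_subalgebra M \<and> id_blinfun \<in> M \<and> op_star M = M \<and> closedin weakstar_topology M"

definition weakstar_left_ideal_generated ::
    "('h::complex_hilbert \<Rightarrow>\<^sub>L 'h) set \<Rightarrow> ('h \<Rightarrow>\<^sub>L 'h) set \<Rightarrow> ('h \<Rightarrow>\<^sub>L 'h) set"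
  where "weakstar_left_ideal_generated M S =
    (\<lambda>J. J \<subseteq> M \<and> op_vs.subspace J \<and> op_prod M J \<subseteq> J \<and> closedin weakstar_topology J) hull S"

definition weakstar_right_ideal_generated ::
    "('h::complex_hilbert \<Rightarrow>\<^sub>L 'h) set \<Rightarrow> ('h \<Rightarrow>\<^sub>L 'h) set \<Rightarrow> ('h \<Rightarrow>\<^sub>L 'h) set"
  where "weakstar_right_ideal_generated M S =
    (\<lambda>J. J \<subseteq> M \<and> op_vs.subspace J \<and> op_prod J M \<subseteq> J \<and> closedin weakstar_topology J) hull S"


section \<open>Support projections\<close>

definition is_projection :: "('h::complex_hilbert \<Rightarrow>\<^sub>L 'h) \<Rightarrow> bool"
  where "is_projection p \<longleftrightarrow> p \<in> B_ops \<and> p o\<^sub>L p = p \<and> is_adjoint p p"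

definition proj_le :: "('h::complex_hilbert \<Rightarrow>\<^sub>L 'h) \<Rightarrow> ('h \<Rightarrow>\<^sub>L 'h) \<Rightarrow> bool"
  where "proj_le p q \<longleftrightarrow> q o\<^sub>L p = p"

definition least_projection ::
    "(('h::complex_hilbert \<Rightarrow>\<^sub>L 'h) \<Rightarrow> bool) \<Rightarrow> ('h \<Rightarrow>\<^sub>L 'h)"
  where "least_projection Q =
    (THE p. is_projection p \<and> Q p \<and> (\<forall>q. is_projection q \<and> Q q \<longrightarrow> proj_le p q))"

(* The left support projection of an operator is the projection onto the closure of its
   range, the right one the projection onto the orthogonal complement of its kernel. *)
definition left_support_op :: "('h::complex_hilbert \<Rightarrow>\<^sub>L 'h) \<Rightarrow> ('h \<Rightarrow>\<^sub>L 'h)"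
  where "left_support_op T = least_projection (\<lambda>p. p o\<^sub>L T = T)"

definition right_support_op :: "('h::complex_hilbert \<Rightarrow>\<^sub>L 'h) \<Rightarrow> ('h \<Rightarrow>\<^sub>L 'h)"
  where "right_support_op T = least_projection (\<lambda>p. T o\<^sub>L p = T)"

definition left_support :: "('h::complex_hilbert \<Rightarrow>\<^sub>L 'h) set \<Rightarrow> ('h \<Rightarrow>\<^sub>L 'h)"
  where "left_support S = least_projection (\<lambda>p. \<forall>T\<in>S. proj_le (left_support_op T) p)"

definition right_support :: "('h::complex_hilbert \<Rightarrow>\<^sub>L 'h) set \<Rightarrow> ('h \<Rightarrow>\<^sub>L 'h)"
  where "right_support S = least_projection (\<lambda>p. \<forall>T\<in>S. proj_le (right_support_op T) p)"


section \<open>Completely bicontractive projections\<close>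

(* The norm of an n by n matrix of operators on H, acting on the Hilbert space sum of n
   copies of H; only the entries with indices below n matter. *)
definition mat_norm :: "nat \<Rightarrow> (nat \<Rightarrow> nat \<Rightarrow> ('h::complex_hilbert \<Rightarrow>\<^sub>L 'h)) \<Rightarrow> real"
  where "mat_norm n a =
    (SUP x\<in>{x :: nat \<Rightarrow> 'h. (\<Sum>j<n. (norm (x j))\<^sup>2) \<le> 1}.
       sqrt (\<Sum>i<n. (norm (\<Sum>j<n. blinfun_apply (a i j) (x j)))\<^sup>2))"

definition completely_contractive_on ::
    "('h::complex_hilbert \<Rightarrow>\<^sub>L 'h) set \<Rightarrow> (('h \<Rightarrow>\<^sub>L 'h) \<Rightarrow> ('h \<Rightarrow>\<^sub>L 'h)) \<Rightarrow> bool"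
  where "completely_contractive_on A F \<longleftrightarrow>
    (\<forall>n a. (\<forall>i<n. \<forall>j<n. a i j \<in> A) \<longrightarrow> mat_norm n (\<lambda>i j. F (a i j)) \<le> mat_norm n a)"

definition linear_projection_on ::
    "('h::complex_hilbert \<Rightarrow>\<^sub>L 'h) set \<Rightarrow> (('h \<Rightarrow>\<^sub>L 'h) \<Rightarrow> ('h \<Rightarrow>\<^sub>L 'h)) \<Rightarrow> bool"
  where "linear_projection_on A P \<longleftrightarrow> P \<in> A \<rightarrow> A \<and>
    (\<forall>S\<in>A. \<forall>T\<in>A. P (S + T) = P S + P T) \<and>
    (\<forall>c. \<forall>T\<in>A. P (op_scale c T) = op_scale c (P T)) \<and>
    (\<forall>T\<in>A. P (P T) = P T)"

definition completely_bicontractive_on ::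
    "('h::complex_hilbert \<Rightarrow>\<^sub>L 'h) set \<Rightarrow> (('h \<Rightarrow>\<^sub>L 'h) \<Rightarrow> ('h \<Rightarrow>\<^sub>L 'h)) \<Rightarrow> bool"
  where "completely_bicontractive_on A P \<longleftrightarrow>
    completely_contractive_on A P \<and> completely_contractive_on A (\<lambda>T. T - P T)"

end

theory Submission
  imports Defs
begin

text \<open>Write \<open>Q = I - P\<close>. Everything rests on two facts about products:

\<^item> \<open>P(y x) = 0\<close> for \<open>y\<close> in the range and \<open>x\<close> in the kernel of \<open>P\<close> (\<open>range_times_kernel\<close>);
\<^item> \<open>Q(c c') = 0\<close> for \<open>c\<close> and \<open>c'\<close> in the kernel of \<open>P\<close> (\<open>kernel_times_kernel\<close>).

Both come from the same device. If \<open>N\<close> is a contractive operator matrix with \<open>N\<^sup>3 = 0\<close>, its Moebius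
transform \<open>(N - e)(1 - e N)\<^sup>-\<^sup>1 = -e + (1 - e\<^sup>2)(N + e N\<^sup>2)\<close> is again a contraction, and it stays one
when \<open>P\<close> or \<open>Q\<close> is applied to its entries. For the first fact, the entries of \<open>N\<close> are \<open>y\<close> and \<open>x\<close>;
\<open>P\<close> removes \<open>x\<close> but keeps \<open>z = P(y x)\<close> from \<open>N\<^sup>2\<close>, so the row \<open>[y, z/2]\<close> is a contraction. That
row lies in the range of \<open>P\<close> again, so the argument repeats and shows that \<open>[y, z/2, ..., z/2]\<close> is a
contraction for every length, whence \<open>z = 0\<close>. For the second fact, the entries of \<open>N\<close> are \<open>c\<close> and
\<open>c'\<close>; \<open>Q\<close> removes the diagonal term \<open>-e\<close> and leaves a matrix of the same shape, in which the corner
has gained \<open>e Q(c c')\<close> at the price of a factor \<open>1 - e\<^sup>2\<close>. The gain is of first order in \<open>e\<close> and the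
loss of second order, so iteration with small \<open>e\<close> makes the corner arbitrarily large unless
\<open>Q(c c') = 0\<close>.

The first fact extends from \<open>y\<close> in the range of \<open>P\<close> to all elements of \<open>D\<close>. As \<open>C\<close> lies in \<open>D\<close> and in
the kernel of \<open>P\<close>, both \<open>P\<close> and \<open>Q\<close> vanish on \<open>C C\<close>, that is, \<open>C C = 0\<close>.

Let \<open>K\<close> be the common kernel of the elements of \<open>C\<close>. The weak* closed left ideal of \<open>M\<close> generated by
\<open>C\<close> consists of the operators in \<open>M\<close> that vanish on \<open>K\<close>, and the right support projection of \<open>C\<close> is the
projection with kernel \<open>K\<close>. So the first hypothesis, in either form, says that the adjoints of the
elements of \<open>P(A)\<close> leave \<open>K\<close> invariant. Then \<open>P(A)\<close>, and with it \<open>D\<close>, leaves the orthogonal complement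
of \<open>K\<close> invariant. An element \<open>c\<close> of \<open>C\<close> therefore maps this complement into itself, but also into
\<open>K\<close>, because \<open>C C = 0\<close>; so \<open>c\<close> vanishes on the complement as well as on \<open>K\<close>. The second hypothesis leads to \<open>C = 0\<close> in the same way, with the
orthogonal complement \<open>R\<close> of the ranges of the elements of \<open>C\<close> in place of \<open>K\<close>. Finally, \<open>C = 0\<close>
means that \<open>D\<close> is contained in \<open>P(A)\<close>, so that \<open>P(A)\<close> is closed under products.\<close>

section \<open>Orthogonal decomposition along a closed subspace\<close>

lemma parallelogram_law:
  fixes x y :: "'a::real_inner"
  shows "(norm (x + y))\<^sup>2 + (norm (x - y))\<^sup>2 = 2 * (norm x)\<^sup>2 + 2 * (norm y)\<^sup>2"
  by (simp add: power2_norm_eq_inner inner_add_left inner_add_right inner_diff_left inner_diff_right)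

text \<open>The projection theorem for closed subspaces: a minimising sequence is a Cauchy sequence by the
parallelogram law.\<close>

lemma closest_point_in_closed_subspace:
  fixes S :: "'a::{real_inner, complete_space} set"
  assumes S: "subspace S" "closed S"
  obtains p where "p \<in> S" "\<And>s. s \<in> S \<Longrightarrow> (norm (x - p))\<^sup>2 \<le> (norm (x - s))\<^sup>2"
proof -
  define d where "d = (INF s\<in>S. (norm (x - s))\<^sup>2)"
  have bdd: "bdd_below ((\<lambda>s. (norm (x - s))\<^sup>2) ` S)"
    by (rule bdd_belowI2[of _ 0]) simp
  have ne: "S \<noteq> {}" using subspace_0[OF S(1)] by auto
  have dle: "d \<le> (norm (x - s))\<^sup>2" if "s \<in> S" for s
    unfolding d_def using bdd that by (rule cINF_lower)
  have "\<exists>s\<in>S. (norm (x - s))\<^sup>2 < d + 1 / real (Suc n)" for n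
  proof -
    have "d < d + 1 / real (Suc n)" by simp
    then show ?thesis unfolding d_def by (subst (asm) cINF_less_iff[OF ne bdd])
  qed
  then obtain s where s: "\<And>n. s n \<in> S" "\<And>n. (norm (x - s n))\<^sup>2 < d + 1 / real (Suc n)"
    by metis
  have close: "(norm (s m - s n))\<^sup>2 \<le> 4 / real (Suc N)" if "m \<ge> N" "n \<ge> N" for m n N
  proof -
    have "(1/2) *\<^sub>R (s m + s n) \<in> S" using s S(1) by (intro subspace_scale subspace_add) auto
    then have "d \<le> (norm (x - (1/2) *\<^sub>R (s m + s n)))\<^sup>2" by (rule dle)
    also have "x - (1/2) *\<^sub>R (s m + s n) = (1/2) *\<^sub>R ((x - s m) + (x - s n))"
      by (simp add: algebra_simps flip: scaleR_add_left)
    also have "(norm \<dots>)\<^sup>2 = (norm ((x - s m) + (x - s n)))\<^sup>2 / 4"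
      by (simp add: power_divide)
    finally have "4 * d \<le> (norm ((x - s m) + (x - s n)))\<^sup>2" by simp
    moreover have "(norm ((x - s m) + (x - s n)))\<^sup>2 + (norm ((x - s m) - (x - s n)))\<^sup>2
        = 2 * (norm (x - s m))\<^sup>2 + 2 * (norm (x - s n))\<^sup>2"
      by (rule parallelogram_law)
    moreover have "norm ((x - s m) - (x - s n)) = norm (s m - s n)"
      by (simp add: norm_minus_commute)
    moreover have "1 / real (Suc m) \<le> 1 / real (Suc N)" "1 / real (Suc n) \<le> 1 / real (Suc N)"
      using that by (auto intro!: divide_left_mono)
    ultimately have "(norm (s m - s n))\<^sup>2 \<le> 4 * (1 / real (Suc N))"
      using s(2)[of m] s(2)[of n] by (smt (verit))
    then show ?thesis by simp
  qed
  have "Cauchy s"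
  proof (rule metric_CauchyI)
    fix e :: real assume e: "e > 0"
    obtain N :: nat where N: "4 / e\<^sup>2 < real N" using reals_Archimedean2 by blast
    have "dist (s m) (s n) < e" if "m \<ge> N" "n \<ge> N" for m n
    proof -
      have "(dist (s m) (s n))\<^sup>2 \<le> 4 / real (Suc N)"
        using close[OF that] by (simp add: dist_norm)
      also have "\<dots> < e\<^sup>2" using N e by (simp add: field_simps) (smt (verit) zero_less_power)
      finally show ?thesis using e by (simp add: power_less_imp_less_base)
    qed
    then show "\<exists>M. \<forall>m\<ge>M. \<forall>n\<ge>M. dist (s m) (s n) < e" by blast
  qed
  then obtain p where p: "s \<longlonglongrightarrow> p" using Cauchy_convergent convergent_def by blast
  have pS: "p \<in> S" using S(2) s(1) p by (rule closed_sequentially)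
  have "(\<lambda>n. (norm (x - s n))\<^sup>2) \<longlonglongrightarrow> (norm (x - p))\<^sup>2" by (intro tendsto_intros p)
  moreover have "(\<lambda>n. d + 1 / real (Suc n)) \<longlonglongrightarrow> d + 0"
    by (intro tendsto_intros LIMSEQ_Suc lim_1_over_n)
  ultimately have "(norm (x - p))\<^sup>2 \<le> d + 0"
    by (rule LIMSEQ_le) (use s(2) less_imp_le in blast)
  then show thesis using that[OF pS] dle by (metis add_0_right order_trans)
qed

lemma orthogonal_decomposition:
  fixes S :: "'a::{real_inner, complete_space} set"
  assumes S: "subspace S" "closed S"
  obtains p where "p \<in> S" "\<And>s. s \<in> S \<Longrightarrow> inner (x - p) s = 0"
proof -
  obtain p where p: "p \<in> S" and min: "\<And>s. s \<in> S \<Longrightarrow> (norm (x - p))\<^sup>2 \<le> (norm (x - s))\<^sup>2"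
    using closest_point_in_closed_subspace[OF S] by blast
  have "inner (x - p) s = 0" if s: "s \<in> S" for s
  proof (cases "s = 0")
    case False
    define i where "i = inner (x - p) s"
    define t where "t = i / (norm s)\<^sup>2"
    have n: "(norm s)\<^sup>2 > 0" using False by simp
    have "p + t *\<^sub>R s \<in> S" using S(1) p s by (intro subspace_add subspace_scale)
    then have "(norm (x - p))\<^sup>2 \<le> (norm (x - (p + t *\<^sub>R s)))\<^sup>2" by (rule min)
    also have "x - (p + t *\<^sub>R s) = (x - p) - t *\<^sub>R s" by simp
    also have "(norm ((x - p) - t *\<^sub>R s))\<^sup>2 = (norm (x - p))\<^sup>2 - 2 * t * i + t * (t * (norm s)\<^sup>2)"
      unfolding i_def by (simp only: power2_norm_eq_inner)
        (simp add: inner_diff_left inner_diff_right inner_commute algebra_simps)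
    also have "t * (norm s)\<^sup>2 = i" using n by (simp add: t_def)
    \<comment> \<open>The choice of \<open>t\<close> minimises the distance along the line through \<open>p\<close> in direction \<open>s\<close>.\<close>
    finally have "t * i \<le> 0" by (simp add: mult.commute)
    then have "i * i / (norm s)\<^sup>2 \<le> 0" by (simp add: t_def)
    then have "i * i \<le> 0" using n by (simp add: divide_le_0_iff)
    then have "i = 0" by (auto simp: mult_le_0_iff)
    then show ?thesis by (simp add: i_def)
  qed simp
  then show thesis using that p by blast
qed

section \<open>The complex inner product\<close>

lemma cinner_add_right: "cinner (x::'h::complex_hilbert) (y + z) = cinner x y + cinner x z"
  by (metis cinner_add_left cinner_commute complex_cnj_add)

lemma cinner_scaleC_right: "cinner (x::'h::complex_hilbert) (c *\<^sub>C y) = cnj c * cinner x y"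
  by (metis cinner_commute cinner_scaleC_left complex_cnj_mult)

lemma cinner_zero_left [simp]: "cinner 0 (x::'h::complex_hilbert) = 0"
  using cinner_add_left[of 0 0 x] by simp

lemma cinner_zero_right [simp]: "cinner (x::'h::complex_hilbert) 0 = 0"
  using cinner_add_right[of x 0 0] by simp

lemma cinner_diff_left: "cinner (x - y) (z::'h::complex_hilbert) = cinner x z - cinner y z"
  using cinner_add_left[of "x - y" y z] by simp

lemma cinner_diff_right: "cinner (z::'h::complex_hilbert) (x - y) = cinner z x - cinner z y"
  using cinner_add_right[of z "x - y" y] by simp

lemma cinner_self_eq_0_iff [simp]: "cinner x x = 0 \<longleftrightarrow> (x::'h::complex_hilbert) = 0"
  by (simp add: cinner_self_of_real)

lemma cinner_eq_0_commute: "cinner x y = 0 \<longleftrightarrow> cinner y (x::'h::complex_hilbert) = 0"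
  by (metis cinner_commute complex_cnj_zero)

lemma eq_0_if_orthogonal: "(\<And>y. cinner x y = 0) \<Longrightarrow> (x::'h::complex_hilbert) = 0"
  using cinner_self_eq_0_iff by blast

lemma all_cinner_eq_0_iff: "(\<forall>g. cinner g x = 0) \<longleftrightarrow> (x::'h::complex_hilbert) = 0"
  using cinner_self_eq_0_iff by (metis cinner_zero_right)

lemma cinner_extensionality:
  fixes x y :: "'h::complex_hilbert"
  shows "(\<forall>z. cinner x z = cinner y z) \<longleftrightarrow> x = y" and "(\<forall>z. cinner z x = cinner z y) \<longleftrightarrow> x = y"
proof -
  have "x = y" if "\<forall>z. cinner x z = cinner y z"
    using eq_0_if_orthogonal[of "x - y"] that by (simp add: cinner_diff_left)
  then show 1: "(\<forall>z. cinner x z = cinner y z) \<longleftrightarrow> x = y" by blast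
  have "x = y" if "\<forall>z. cinner z x = cinner z y"
    using that 1 by (simp add: cinner_commute[of x] cinner_commute[of y])
  then show "(\<forall>z. cinner z x = cinner z y) \<longleftrightarrow> x = y" by blast
qed

lemma cmod_cinner_le: "cmod (cinner x y) \<le> norm x * norm (y::'h::complex_hilbert)"
proof (cases "cinner x y = 0")
  case False
  define c where "c = cnj (sgn (cinner x y))"
  have c: "cmod c = 1" using False by (simp add: c_def norm_sgn)
  have "cinner (c *\<^sub>C x) y = complex_of_real (cmod (cinner x y))"
  proof -
    have "c * cinner x y = cnj (cinner x y) * cinner x y / cmod (cinner x y)"
      by (simp add: c_def sgn_eq)
    also have "\<dots> = complex_of_real ((cmod (cinner x y))\<^sup>2) / cmod (cinner x y)"
      by (simp only: complex_norm_square mult.commute)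
    also have "\<dots> = complex_of_real (cmod (cinner x y))" by (simp add: power2_eq_square)
    finally show ?thesis by (simp add: cinner_scaleC_left)
  qed
  then have "cmod (cinner x y) = inner (c *\<^sub>C x) y" by (simp add: inner_eq_Re_cinner)
  also have "\<dots> \<le> norm (c *\<^sub>C x) * norm y" by (rule norm_cauchy_schwarz)
  finally show ?thesis using c by (simp add: norm_scaleC)
qed simp

lemma bounded_linear_cinner_left: "bounded_linear (\<lambda>x. cinner x (y::'h::complex_hilbert))"
proof (rule bounded_linear_intro[where K = "norm y"])
  show "cinner (r *\<^sub>R x) y = r *\<^sub>R cinner x y" for r x
    by (simp add: scaleR_scaleC cinner_scaleC_left scaleC_complex_def)
qed (simp_all add: cinner_add_left cmod_cinner_le)

lemma bounded_linear_cinner_right: "bounded_linear (cinner (x::'h::complex_hilbert))"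
proof (rule bounded_linear_intro[where K = "norm x"])
  show "cinner x (r *\<^sub>R y) = r *\<^sub>R cinner x y" for r y
    by (simp add: scaleR_scaleC cinner_scaleC_right scaleC_complex_def)
  show "norm (cinner x y) \<le> norm y * norm x" for y
    using cmod_cinner_le[of x y] by (simp add: mult.commute)
qed (simp_all add: cinner_add_right)

section \<open>Complex subspaces and projections\<close>

definition csubspace :: "'h::complex_hilbert set \<Rightarrow> bool"
  where "csubspace K \<longleftrightarrow> 0 \<in> K \<and> (\<forall>x\<in>K. \<forall>y\<in>K. x + y \<in> K) \<and> (\<forall>c. \<forall>x\<in>K. c *\<^sub>C x \<in> K)"

lemma csubspace_imp_subspace: "csubspace K \<Longrightarrow> subspace K"
  unfolding csubspace_def subspace_def by (auto simp: scaleR_scaleC)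

lemma scaleC_zero_right [simp]: "c *\<^sub>C (0::'h::complex_hilbert) = 0"
  by (metis mult_zero_right norm_eq_zero norm_scaleC)

lemma orthogonal_decomposition_complex:
  fixes K :: "'h::complex_hilbert set"
  assumes K: "csubspace K" "closed K"
  obtains p where "p \<in> K" "\<And>k. k \<in> K \<Longrightarrow> cinner (x - p) k = 0"
proof -
  obtain p where p: "p \<in> K" and orth: "\<And>k. k \<in> K \<Longrightarrow> inner (x - p) k = 0"
    using orthogonal_decomposition[OF csubspace_imp_subspace[OF K(1)] K(2)] by blast
  have "cinner (x - p) k = 0" if "k \<in> K" for k
  proof -
    \<comment> \<open>Real orthogonality to \<open>k\<close> and to \<open>\<i> k\<close> controls the real and the imaginary part.\<close>
    have "\<i> *\<^sub>C k \<in> K" using K(1) that by (simp add: csubspace_def)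
    then have "Re (cinner (x - p) (\<i> *\<^sub>C k)) = 0" using orth by (simp add: inner_eq_Re_cinner)
    then have "Im (cinner (x - p) k) = 0" by (simp add: cinner_scaleC_right)
    moreover have "Re (cinner (x - p) k) = 0" using orth[OF that] by (simp add: inner_eq_Re_cinner)
    ultimately show ?thesis by (simp add: complex_eq_iff)
  qed
  then show thesis using that p by blast
qed

text \<open>Projections are described by their kernels throughout, because the kernel of a support projection is
a set that can be written down without taking closures.\<close>

lemma exists_projection_with_kernel:
  fixes K :: "'h::complex_hilbert set"
  assumes K: "csubspace K" "closed K"
  obtains p where "is_projection p" "\<And>x. p x = 0 \<longleftrightarrow> x \<in> K"
proof -
  have sub: "subspace K" using K(1) by (rule csubspace_imp_subspace)
  have "\<forall>x. \<exists>p. p \<in> K \<and> (\<forall>k\<in>K. cinner (x - p) k = 0)"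
  proof
    fix x
    show "\<exists>p. p \<in> K \<and> (\<forall>k\<in>K. cinner (x - p) k = 0)"
      by (rule orthogonal_decomposition_complex[OF K, of x]) blast
  qed
  from choice[OF this] obtain g where "\<forall>x. g x \<in> K \<and> (\<forall>k\<in>K. cinner (x - g x) k = 0)" ..
  then have g: "\<And>x. g x \<in> K" "\<And>x k. k \<in> K \<Longrightarrow> cinner (x - g x) k = 0" by auto
  have uniq: "q = g x" if "q \<in> K" "\<And>k. k \<in> K \<Longrightarrow> cinner (x - q) k = 0" for q x
  proof -
    have "cinner (q - g x) (q - g x) = cinner (x - g x) (q - g x) - cinner (x - q) (q - g x)"
      by (simp flip: cinner_diff_left)
    also have "\<dots> = 0" using g(2) that subspace_diff[OF sub that(1) g(1)] by simp
    finally show ?thesis by simp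
  qed
  \<comment> \<open>\<open>g\<close> is the projection onto \<open>K\<close>, and \<open>f\<close> the complementary one.\<close>
  define f where "f x = x - g x" for x
  have f_orth: "cinner (f x) k = 0" if "k \<in> K" for x k using g(2) that by (simp add: f_def)
  have add: "f (x + y) = f x + f y" for x y
  proof -
    have "g x + g y = g (x + y)"
    proof (rule uniq)
      fix k assume "k \<in> K"
      then have "cinner ((x - g x) + (y - g y)) k = 0" by (simp add: cinner_add_left g(2))
      then show "cinner (x + y - (g x + g y)) k = 0" by (simp add: algebra_simps)
    qed (use g(1) K(1) in \<open>simp add: csubspace_def\<close>)
    then show ?thesis by (simp add: f_def algebra_simps)
  qed
  have scale: "f (c *\<^sub>C x) = c *\<^sub>C f x" for c x
  proof -
    have eq: "c *\<^sub>C (x - g x) = c *\<^sub>C x - c *\<^sub>C g x"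
      by (rule linear_diff) (rule bounded_linear.linear[OF bounded_linear_scaleC])
    have "c *\<^sub>C g x = g (c *\<^sub>C x)"
    proof (rule uniq)
      fix k assume "k \<in> K"
      then show "cinner (c *\<^sub>C x - c *\<^sub>C g x) k = 0"
        unfolding eq[symmetric] by (simp add: cinner_scaleC_left g(2))
    qed (use g(1) K(1) in \<open>simp add: csubspace_def\<close>)
    then show ?thesis by (simp add: f_def eq)
  qed
  have sa: "cinner (f x) y = cinner x (f y)" for x y
  proof -
    have "cinner (f x) y = cinner (f x) (f y) + cinner (f x) (g y)"
      by (simp add: f_def flip: cinner_add_right)
    moreover have "cinner x (f y) = cinner (f x) (f y) + cinner (g x) (f y)"
      by (simp add: f_def flip: cinner_add_left)
    moreover have "cinner (g x) (f y) = 0"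
      using f_orth[OF g(1)] cinner_eq_0_commute by blast
    ultimately show ?thesis by (simp add: f_orth g(1))
  qed
  have idem: "f (f x) = f x" for x
  proof -
    have "0 = g (f x)" by (rule uniq) (simp_all add: f_orth subspace_0[OF sub])
    then show ?thesis by (simp add: f_def[of "f x"])
  qed
  have bound: "norm (f x) \<le> norm x" for x
  proof -
    have "cinner x (f x) = complex_of_real ((norm (f x))\<^sup>2)"
      using sa[of x "f x"] by (simp add: cinner_self_of_real idem)
    then have "cmod (cinner x (f x)) = (norm (f x))\<^sup>2"
      by (simp only: norm_of_real abs_power2)
    then have "(norm (f x))\<^sup>2 \<le> norm x * norm (f x)"
      using cmod_cinner_le[of x "f x"] by simp
    then show ?thesis
      by (cases "f x = 0") (auto simp: power2_eq_square)
  qed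
  have "bounded_linear f"
  proof (rule bounded_linear_intro[where K = 1])
    show "f (r *\<^sub>R x) = r *\<^sub>R f x" for r x by (simp add: scaleR_scaleC scale)
  qed (simp_all add: add bound)
  then have app: "blinfun_apply (Blinfun f) = f" by (rule bounded_linear_Blinfun_apply)
  show thesis
  proof
    show "is_projection (Blinfun f)"
      unfolding is_projection_def
    proof (intro conjI)
      show "Blinfun f \<in> B_ops" by (simp add: B_ops_def app scale)
      show "Blinfun f o\<^sub>L Blinfun f = Blinfun f" by (rule blinfun_eqI) (simp add: app idem)
      show "is_adjoint (Blinfun f) (Blinfun f)" by (simp add: is_adjoint_def app sa)
    qed
    show "Blinfun f x = 0 \<longleftrightarrow> x \<in> K" for x
    proof
      assume "Blinfun f x = 0"
      then have "x = g x" by (simp add: app f_def)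
      then show "x \<in> K" using g(1) by metis
    next
      assume "x \<in> K"
      then have "x = g x" by (intro uniq) simp_all
      then show "Blinfun f x = 0" by (simp add: app f_def)
    qed
  qed
qed

lemma projection_selfadjoint: "is_projection p \<Longrightarrow> cinner (p x) y = cinner x (p y)"
  by (simp add: is_projection_def is_adjoint_def)

lemma projection_idem: "is_projection p \<Longrightarrow> p (p x) = p x"
  unfolding is_projection_def by (metis blinfun_apply_blinfun_compose)

lemma blinfun_compose_eq_iff: "S o\<^sub>L T = U \<longleftrightarrow> (\<forall>x. blinfun_apply S (blinfun_apply T x) = blinfun_apply U x)"
  by (metis blinfun_apply_blinfun_compose blinfun_eqI)

text \<open>The order of projections is reverse inclusion of kernels; passing to adjoints turns \<open>q p = p\<close> into
\<open>p q = p\<close>.\<close>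

lemma proj_le_iff_kernel:
  assumes p: "is_projection p" and q: "is_projection q"
  shows "proj_le p q \<longleftrightarrow> (\<forall>x. q x = 0 \<longrightarrow> p x = 0)"
proof -
  have swap: "(\<forall>x. q (p x) = p x) \<longleftrightarrow> (\<forall>x. p (q x) = p x)"
  proof -
    have "(\<forall>x. q (p x) = p x) \<longleftrightarrow> (\<forall>x y. cinner (q (p x)) y = cinner (p x) y)"
      by (simp only: cinner_extensionality)
    also have "\<dots> \<longleftrightarrow> (\<forall>y x. cinner x (p (q y)) = cinner x (p y))"
      by (simp only: projection_selfadjoint[OF p] projection_selfadjoint[OF q]) blast
    also have "\<dots> \<longleftrightarrow> (\<forall>y. p (q y) = p y)"
      by (simp only: cinner_extensionality)
    finally show ?thesis .
  qed
  have "proj_le p q \<longleftrightarrow> (\<forall>x. q (p x) = p x)"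
    unfolding proj_le_def by (rule blinfun_compose_eq_iff)
  also have "\<dots> \<longleftrightarrow> (\<forall>x. p (q x) = p x)" by (rule swap)
  also have "\<dots> \<longleftrightarrow> (\<forall>x. q x = 0 \<longrightarrow> p x = 0)"
  proof (intro iffI allI impI)
    fix x assume "\<forall>x. p (q x) = p x" "q x = 0"
    then show "p x = 0" by (metis blinfun.zero_right)
  next
    fix x assume *: "\<forall>x. q x = 0 \<longrightarrow> p x = 0"
    have "q (x - q x) = 0" by (simp add: blinfun.diff_right projection_idem[OF q])
    then have "p (x - q x) = 0" using * by blast
    then show "p (q x) = p x" by (simp add: blinfun.diff_right)
  qed
  finally show ?thesis .
qed

lemma projection_eqI:
  assumes p: "is_projection p" and q: "is_projection q" and eq: "\<And>x. p x = 0 \<longleftrightarrow> q x = 0"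
  shows "p = q"
proof -
  have "proj_le p q" using eq by (simp add: proj_le_iff_kernel[OF p q])
  then have 1: "q (p x) = p x" for x
    unfolding proj_le_def by (metis blinfun_apply_blinfun_compose)
  show ?thesis
  proof (rule blinfun_eqI)
    fix x
    have "p (x - p x) = 0" by (simp add: blinfun.diff_right projection_idem[OF p])
    then have "q (x - p x) = 0" using eq by blast
    then show "p x = q x" using 1[of x] by (simp add: blinfun.diff_right)
  qed
qed

text \<open>The form in which every support projection arises: its defining property holds of exactly those
projections whose kernel is contained in a fixed closed subspace \<open>K\<close>.\<close>

lemma least_projection_kernel:
  assumes K: "csubspace K" "closed K"
    and Q: "\<And>q. is_projection q \<Longrightarrow> Q q \<longleftrightarrow> (\<forall>x. q x = 0 \<longrightarrow> x \<in> K)"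
  shows "is_projection (least_projection Q)" and "least_projection Q x = 0 \<longleftrightarrow> x \<in> K"
proof -
  obtain p where p: "is_projection p" and ker: "\<And>x. p x = 0 \<longleftrightarrow> x \<in> K"
    using exists_projection_with_kernel[OF K] by blast
  have "least_projection Q = p"
    unfolding least_projection_def
  proof (rule the_equality)
    show "is_projection p \<and> Q p \<and> (\<forall>q. is_projection q \<and> Q q \<longrightarrow> proj_le p q)"
      using p Q[OF p] Q by (auto simp: ker proj_le_iff_kernel[OF p])
  next
    fix r assume r: "is_projection r \<and> Q r \<and> (\<forall>q. is_projection q \<and> Q q \<longrightarrow> proj_le r q)"
    then have "proj_le r p" using p Q[OF p] ker by blast
    then show "r = p"
      using r p Q[of r] ker by (intro projection_eqI) (auto simp: proj_le_iff_kernel)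
  qed
  with p ker show "is_projection (least_projection Q)" "least_projection Q x = 0 \<longleftrightarrow> x \<in> K"
    by auto
qed

lemma csubspace_INT: "(\<And>T. T \<in> S \<Longrightarrow> csubspace (K T)) \<Longrightarrow> csubspace {x. \<forall>T\<in>S. x \<in> K T}"
  by (auto simp: csubspace_def)

lemma closed_INT_Collect: "(\<And>T. T \<in> S \<Longrightarrow> closed (K T)) \<Longrightarrow> closed {x. \<forall>T\<in>S. x \<in> K T}"
proof -
  assume "\<And>T. T \<in> S \<Longrightarrow> closed (K T)"
  then have "closed (\<Inter>T\<in>S. K T)" by (intro closed_INT) blast
  moreover have "(\<Inter>T\<in>S. K T) = {x. \<forall>T\<in>S. x \<in> K T}" by auto
  ultimately show ?thesis by simp
qed

lemma left_support_op_kernel: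
  fixes T :: "'h::complex_hilbert \<Rightarrow>\<^sub>L 'h"
  shows "is_projection (left_support_op T)"
    and "left_support_op T k = 0 \<longleftrightarrow> (\<forall>g. cinner (T g) k = 0)"
    and "csubspace {k. \<forall>g. cinner (T g) k = 0}" and "closed {k. \<forall>g. cinner (T g) k = 0}"
proof -
  show c: "csubspace {k. \<forall>g. cinner (T g) k = 0}"
    by (simp add: csubspace_def cinner_add_right cinner_scaleC_right)
  show cl: "closed {k. \<forall>g. cinner (T g) k = 0}"
    by (intro closed_Collect_all closed_Collect_eq continuous_intros
        bounded_linear.continuous_on[OF bounded_linear_cinner_right] continuous_on_id)
  have Q: "q o\<^sub>L T = T \<longleftrightarrow> (\<forall>x. q x = 0 \<longrightarrow> x \<in> {k. \<forall>g. cinner (T g) k = 0})"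
    if q: "is_projection q" for q
  proof
    assume "q o\<^sub>L T = T"
    then have qT: "q (T g) = T g" for g by (simp add: blinfun_compose_eq_iff)
    have "cinner (T g) x = 0" if "q x = 0" for x g
      using projection_selfadjoint[OF q, of "T g" x] that by (simp add: qT)
    then show "\<forall>x. q x = 0 \<longrightarrow> x \<in> {k. \<forall>g. cinner (T g) k = 0}" by blast
  next
    assume *: "\<forall>x. q x = 0 \<longrightarrow> x \<in> {k. \<forall>g. cinner (T g) k = 0}"
    show "q o\<^sub>L T = T"
    proof (rule blinfun_eqI)
      fix g
      define r where "r = T g - q (T g)"
      have "q r = 0" by (simp add: r_def blinfun.diff_right projection_idem[OF q])
      then have "cinner (T g) r = 0" "cinner (q (T g)) r = 0"
        using * projection_selfadjoint[OF q, of "T g" r] by auto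
      then have "cinner r r = 0" by (simp add: r_def cinner_diff_left)
      then show "(q o\<^sub>L T) g = T g" by (simp add: r_def)
    qed
  qed
  show "is_projection (left_support_op T)"
    "left_support_op T k = 0 \<longleftrightarrow> (\<forall>g. cinner (T g) k = 0)"
    unfolding left_support_op_def using least_projection_kernel[OF c cl Q] by auto
qed

lemma left_support_kernel:
  fixes S :: "('h::complex_hilbert \<Rightarrow>\<^sub>L 'h) set"
  shows "is_projection (left_support S)"
    and "left_support S k = 0 \<longleftrightarrow> (\<forall>T\<in>S. \<forall>g. cinner (T g) k = 0)"
proof -
  let ?K = "{x. \<forall>T\<in>S. x \<in> {k. \<forall>g. cinner (T g) k = 0}}"
  have c: "csubspace ?K" by (intro csubspace_INT left_support_op_kernel(3))
  have cl: "closed ?K" by (intro closed_INT_Collect left_support_op_kernel(4))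
  have Q: "(\<forall>T\<in>S. proj_le (left_support_op T) q) \<longleftrightarrow> (\<forall>x. q x = 0 \<longrightarrow> x \<in> ?K)"
    if "is_projection q" for q
    by (auto simp: proj_le_iff_kernel[OF left_support_op_kernel(1) that] left_support_op_kernel(2))
  show "is_projection (left_support S)"
    "left_support S k = 0 \<longleftrightarrow> (\<forall>T\<in>S. \<forall>g. cinner (T g) k = 0)"
    unfolding left_support_def using least_projection_kernel[OF c cl Q] by auto
qed

lemma right_support_op_kernel:
  fixes T :: "'h::complex_hilbert \<Rightarrow>\<^sub>L 'h"
  assumes T: "T \<in> B_ops"
  shows "is_projection (right_support_op T)"
    and "right_support_op T k = 0 \<longleftrightarrow> T k = 0"
    and "csubspace {k. T k = 0}" and "closed {k. T k = 0}"
proof -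
  show c: "csubspace {k. T k = 0}"
    using T by (simp add: csubspace_def blinfun.add_right B_ops_def)
  show cl: "closed {k. T k = 0}"
    by (intro closed_Collect_eq continuous_intros)
  have Q: "T o\<^sub>L q = T \<longleftrightarrow> (\<forall>x. q x = 0 \<longrightarrow> x \<in> {k. T k = 0})"
    if q: "is_projection q" for q
  proof
    assume "T o\<^sub>L q = T"
    then have Tq: "T (q g) = T g" for g by (simp add: blinfun_compose_eq_iff)
    show "\<forall>x. q x = 0 \<longrightarrow> x \<in> {k. T k = 0}"
    proof (intro allI impI)
      fix x assume "q x = 0"
      then show "x \<in> {k. T k = 0}" using Tq[of x] by simp
    qed
  next
    assume *: "\<forall>x. q x = 0 \<longrightarrow> x \<in> {k. T k = 0}"
    show "T o\<^sub>L q = T"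
    proof (rule blinfun_eqI)
      fix g
      have "q (g - q g) = 0" by (simp add: blinfun.diff_right projection_idem[OF q])
      then have "T (g - q g) = 0" using * by blast
      then show "(T o\<^sub>L q) g = T g" by (simp add: blinfun.diff_right)
    qed
  qed
  show "is_projection (right_support_op T)" "right_support_op T k = 0 \<longleftrightarrow> T k = 0"
    unfolding right_support_op_def using least_projection_kernel[OF c cl Q] by auto
qed

lemma right_support_kernel:
  fixes S :: "('h::complex_hilbert \<Rightarrow>\<^sub>L 'h) set"
  assumes S: "S \<subseteq> B_ops"
  shows "is_projection (right_support S)"
    and "right_support S k = 0 \<longleftrightarrow> (\<forall>T\<in>S. T k = 0)"
proof -
  let ?K = "{x. \<forall>T\<in>S. x \<in> {k. T k = 0}}"
  have c: "csubspace ?K" using S by (intro csubspace_INT right_support_op_kernel(3)) auto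
  have cl: "closed ?K" using S by (intro closed_INT_Collect right_support_op_kernel(4)) auto
  have Q: "(\<forall>T\<in>S. proj_le (right_support_op T) q) \<longleftrightarrow> (\<forall>x. q x = 0 \<longrightarrow> x \<in> ?K)"
    if "is_projection q" for q
    using S by (auto simp: proj_le_iff_kernel[OF right_support_op_kernel(1) that]
        right_support_op_kernel(2) subset_iff)
  show "is_projection (right_support S)" "right_support S k = 0 \<longleftrightarrow> (\<forall>T\<in>S. T k = 0)"
    unfolding right_support_def using least_projection_kernel[OF c cl Q] by auto
qed

section \<open>Matrices of operators as contractions\<close>

text \<open>The condition \<open>mat_norm n a \<le> 1\<close> without the supremum, so that it can be used one vector at a time.\<close>

definition mat_contraction :: "nat \<Rightarrow> (nat \<Rightarrow> nat \<Rightarrow> ('h::complex_hilbert \<Rightarrow>\<^sub>L 'h)) \<Rightarrow> bool"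
  where "mat_contraction n a \<longleftrightarrow>
    (\<forall>x. (\<Sum>i<n. (norm (\<Sum>j<n. blinfun_apply (a i j) (x j)))\<^sup>2) \<le> (\<Sum>j<n. (norm (x j))\<^sup>2))"

lemma mat_norm_bdd_above:
  "bdd_above ((\<lambda>x. sqrt (\<Sum>i<n. (norm (\<Sum>j<n. blinfun_apply (a i j) (x j)))\<^sup>2)) `
    {x :: nat \<Rightarrow> 'h::complex_hilbert. (\<Sum>j<n. (norm (x j))\<^sup>2) \<le> 1})"
proof (rule bdd_aboveI2)
  fix x :: "nat \<Rightarrow> 'h"
  assume "x \<in> {x. (\<Sum>j<n. (norm (x j))\<^sup>2) \<le> 1}"
  then have x: "(\<Sum>j<n. (norm (x j))\<^sup>2) \<le> 1" by simp
  have nx: "norm (x j) \<le> 1" if "j < n" for j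
  proof -
    have "(norm (x j))\<^sup>2 \<le> (\<Sum>j<n. (norm (x j))\<^sup>2)"
      using that by (intro member_le_sum) auto
    with x have "(norm (x j))\<^sup>2 \<le> 1\<^sup>2" by simp
    then show ?thesis by (rule power2_le_imp_le) simp
  qed
  have "norm (\<Sum>j<n. blinfun_apply (a i j) (x j)) \<le> (\<Sum>j<n. norm (a i j))" for i
  proof (rule sum_norm_le)
    fix j assume "j \<in> {..<n}"
    then have "norm (a i j) * norm (x j) \<le> norm (a i j) * 1"
      by (intro mult_left_mono nx) auto
    then show "norm (blinfun_apply (a i j) (x j)) \<le> norm (a i j)"
      using norm_blinfun[of "a i j" "x j"] by simp
  qed
  then show "sqrt (\<Sum>i<n. (norm (\<Sum>j<n. blinfun_apply (a i j) (x j)))\<^sup>2)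
      \<le> sqrt (\<Sum>i<n. (\<Sum>j<n. norm (a i j))\<^sup>2)"
    by (intro real_sqrt_le_mono sum_mono power_mono) auto
qed

lemma mat_norm_le_1_iff: "mat_norm n a \<le> 1 \<longleftrightarrow> mat_contraction n a"
proof
  assume c: "mat_contraction n a"
  show "mat_norm n a \<le> 1"
    unfolding mat_norm_def
  proof (rule cSUP_least)
    have "(\<lambda>_. 0) \<in> {x :: nat \<Rightarrow> 'a. (\<Sum>j<n. (norm (x j))\<^sup>2) \<le> 1}" by simp
    then show "{x :: nat \<Rightarrow> 'a. (\<Sum>j<n. (norm (x j))\<^sup>2) \<le> 1} \<noteq> {}" by (rule ex_in_conv[THEN iffD1, OF exI])
  next
    fix x :: "nat \<Rightarrow> 'a" assume "x \<in> {x. (\<Sum>j<n. (norm (x j))\<^sup>2) \<le> 1}"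
    then have "(\<Sum>j<n. (norm (x j))\<^sup>2) \<le> 1" by simp
    with c have "(\<Sum>i<n. (norm (\<Sum>j<n. blinfun_apply (a i j) (x j)))\<^sup>2) \<le> 1"
      unfolding mat_contraction_def by (blast intro: order_trans)
    then show "sqrt (\<Sum>i<n. (norm (\<Sum>j<n. blinfun_apply (a i j) (x j)))\<^sup>2) \<le> 1"
      by simp
  qed
next
  assume m: "mat_norm n a \<le> 1"
  have unit: "(\<Sum>i<n. (norm (\<Sum>j<n. blinfun_apply (a i j) (x j)))\<^sup>2) \<le> 1"
    if "(\<Sum>j<n. (norm (x j))\<^sup>2) \<le> 1" for x
  proof -
    have "sqrt (\<Sum>i<n. (norm (\<Sum>j<n. blinfun_apply (a i j) (x j)))\<^sup>2) \<le> mat_norm n a"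
      unfolding mat_norm_def using that by (intro cSUP_upper mat_norm_bdd_above) auto
    with m have "sqrt (\<Sum>i<n. (norm (\<Sum>j<n. blinfun_apply (a i j) (x j)))\<^sup>2) \<le> 1"
      by (rule order_trans[rotated])
    then show ?thesis by simp
  qed
  show "mat_contraction n a"
    unfolding mat_contraction_def
  proof
    fix x :: "nat \<Rightarrow> 'a"
    define s where "s = (\<Sum>j<n. (norm (x j))\<^sup>2)"
    define t where "t = (\<Sum>i<n. (norm (\<Sum>j<n. blinfun_apply (a i j) (x j)))\<^sup>2)"
    have s0: "s \<ge> 0" by (simp add: s_def sum_nonneg)
    show "t \<le> s"
    proof (cases "s = 0")
      case True
      then have "\<forall>j\<in>{..<n}. (norm (x j))\<^sup>2 = 0"
        unfolding s_def by (subst (asm) sum_nonneg_eq_0_iff) auto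
      then have "t = 0" by (simp add: t_def)
      then show ?thesis using True by simp
    next
      case False
      then have s: "s > 0" using s0 by simp
      define r where "r = 1 / sqrt s"
      have r2: "r\<^sup>2 = 1 / s" using s by (simp add: r_def power_divide)
      have "(\<Sum>j<n. (norm (r *\<^sub>R x j))\<^sup>2) = r\<^sup>2 * s"
        by (simp add: s_def sum_distrib_left power_mult_distrib)
      moreover have "(\<Sum>i<n. (norm (\<Sum>j<n. blinfun_apply (a i j) (r *\<^sub>R x j)))\<^sup>2) = r\<^sup>2 * t"
        by (simp add: t_def sum_distrib_left power_mult_distrib blinfun.scaleR_right
            scaleR_sum_right[symmetric])
      ultimately have "r\<^sup>2 * t \<le> 1"
        using unit[of "\<lambda>j. r *\<^sub>R x j"] s by (simp add: r2)
      then show ?thesis using s by (simp add: r2)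
    qed
  qed
qed

lemma completely_contractive_on_contraction:
  assumes "completely_contractive_on A F"
    and "\<And>i j. i < n \<Longrightarrow> j < n \<Longrightarrow> a i j \<in> A"
    and "mat_contraction n a"
  shows "mat_contraction n (\<lambda>i j. F (a i j))"
proof -
  have "mat_norm n (\<lambda>i j. F (a i j)) \<le> mat_norm n a"
    using assms(1,2) unfolding completely_contractive_on_def by blast
  then show ?thesis
    using assms(3) unfolding mat_norm_le_1_iff[symmetric] by (rule order_trans)
qed

lemma sum_lessThan_3: "(\<Sum>i<3. f i) = f 0 + f 1 + f (2::nat)" for f :: "nat \<Rightarrow> 'a::comm_monoid_add"
proof -
  have "{..<3::nat} = {0, 1, 2}" by auto
  then show ?thesis by (simp add: add.assoc)
qed

lemma sum_lessThan_4: "(\<Sum>i<4. f i) = f 0 + f 1 + f 2 + f (3::nat)" for f :: "nat \<Rightarrow> 'a::comm_monoid_add"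
proof -
  have "{..<4::nat} = {0, 1, 2, 3}" by auto
  then show ?thesis by (simp add: add.assoc)
qed

lemma mobius_norm_identity:
  fixes v w :: "'a::real_inner"
  shows "(norm (v - e *\<^sub>R w))\<^sup>2 - (norm (w - e *\<^sub>R v))\<^sup>2 = (1 - e\<^sup>2) * ((norm v)\<^sup>2 - (norm w)\<^sup>2)"
  by (simp add: power2_norm_eq_inner inner_diff_left inner_diff_right inner_commute)
     (simp add: algebra_simps power2_eq_square)

text \<open>If \<open>w = N v\<close> for a contraction \<open>N\<close>, this says that \<open>(N - e)(1 - e N)\<^sup>-\<^sup>1\<close> is a contraction, without
mentioning the inverse.\<close>

lemma mobius_contraction:
  fixes v w :: "nat \<Rightarrow> 'a::real_inner"
  assumes "(\<Sum>i<n. (norm (w i))\<^sup>2) \<le> (\<Sum>i<n. (norm (v i))\<^sup>2)" and "e\<^sup>2 \<le> 1"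
  shows "(\<Sum>i<n. (norm (w i - e *\<^sub>R v i))\<^sup>2) \<le> (\<Sum>i<n. (norm (v i - e *\<^sub>R w i))\<^sup>2)"
proof -
  have "(\<Sum>i<n. (norm (v i - e *\<^sub>R w i))\<^sup>2) - (\<Sum>i<n. (norm (w i - e *\<^sub>R v i))\<^sup>2)
      = (1 - e\<^sup>2) * ((\<Sum>i<n. (norm (v i))\<^sup>2) - (\<Sum>i<n. (norm (w i))\<^sup>2))"
    by (simp only: sum_subtractf[symmetric] sum_distrib_left mobius_norm_identity)
  also have "\<dots> \<ge> 0" using assms by simp
  finally show ?thesis by simp
qed

section \<open>Projections on unital operator algebras\<close>

lemma op_scale_of_real: "op_scale (complex_of_real r) T = r *\<^sub>R T"
  by (rule blinfun_eqI) (simp add: op_scale.rep_eq scaleR_scaleC blinfun.scaleR_left)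

lemma subspace_op_vs_imp_subspace:
  assumes "op_vs.subspace V" shows "subspace V"
  unfolding subspace_def
  using op_vs.subspace_0[OF assms] op_vs.subspace_add[OF assms]
    op_vs.subspace_scale[OF assms, of _ "complex_of_real _"]
  by (simp add: op_scale_of_real)

text \<open>Both facts about products are obtained by letting multiples of an unwanted operator grow beyond a
fixed bound.\<close>

lemma eq_0_if_bounded_multiples:
  fixes z :: "'h::real_normed_vector \<Rightarrow>\<^sub>L 'h"
  assumes "\<And>m::nat. (real m * c) * (norm (z k))\<^sup>2 \<le> d" and "c > 0"
  shows "z k = 0"
proof (rule ccontr)
  assume "z k \<noteq> 0"
  then have "c * (norm (z k))\<^sup>2 > 0" using assms(2) by simp
  then obtain m :: nat where "d < real m * (c * (norm (z k))\<^sup>2)"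
    using reals_Archimedean3 by blast
  with assms(1)[of m] show False by (simp add: mult.assoc)
qed

lemma exists_normalising_scalar:
  fixes T :: "'h::real_normed_vector \<Rightarrow>\<^sub>L 'h"
  obtains r :: real where "r > 0" "norm (r *\<^sub>R T) \<le> 1"
proof
  show "1 / (1 + norm T) > 0" by (simp add: add_pos_nonneg)
  show "norm ((1 / (1 + norm T)) *\<^sub>R T) \<le> 1" by (simp add: field_simps add_pos_nonneg)
qed

lemma norm_apply_le_if_norm_le_1: "norm T \<le> 1 \<Longrightarrow> norm (blinfun_apply T h) \<le> norm h"
  using norm_blinfun[of T h] mult_right_mono[of "norm T" 1 "norm h"] by simp

locale unital_projection =
  fixes A :: "('h::complex_hilbert \<Rightarrow>\<^sub>L 'h) set" and P
  assumes A: "unital_operator_algebra A"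
    and proj: "linear_projection_on A P"
    and unit: "P id_blinfun = id_blinfun"
begin

lemma subalgebra_A: "op_subalgebra A"
  and A_0 [simp]: "0 \<in> A" and A_id [simp]: "id_blinfun \<in> A"
  and A_add: "S \<in> A \<Longrightarrow> T \<in> A \<Longrightarrow> S + T \<in> A"
  and A_diff: "S \<in> A \<Longrightarrow> T \<in> A \<Longrightarrow> S - T \<in> A"
  and A_scaleR: "T \<in> A \<Longrightarrow> r *\<^sub>R T \<in> A"
  and A_compose: "S \<in> A \<Longrightarrow> T \<in> A \<Longrightarrow> S o\<^sub>L T \<in> A"
  and A_minus: "T \<in> A \<Longrightarrow> - T \<in> A"
  and A_closed: "closed A"
proof -
  show s: "op_subalgebra A" and "closed A" and "id_blinfun \<in> A"
    using A by (auto simp: unital_operator_algebra_def)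
  then have sub: "subspace A"
    by (auto simp: op_subalgebra_def intro: subspace_op_vs_imp_subspace)
  show "0 \<in> A" "S \<in> A \<Longrightarrow> T \<in> A \<Longrightarrow> S + T \<in> A" "S \<in> A \<Longrightarrow> T \<in> A \<Longrightarrow> S - T \<in> A"
    "T \<in> A \<Longrightarrow> r *\<^sub>R T \<in> A" "T \<in> A \<Longrightarrow> - T \<in> A"
    using sub by (auto intro: subspace_0 subspace_add subspace_diff subspace_scale subspace_neg)
  show "S \<in> A \<Longrightarrow> T \<in> A \<Longrightarrow> S o\<^sub>L T \<in> A"
    using s by (auto simp: op_subalgebra_def op_prod_def)
qed

lemma P_in: "T \<in> A \<Longrightarrow> P T \<in> A" and P_idem: "T \<in> A \<Longrightarrow> P (P T) = P T"
  and P_add: "S \<in> A \<Longrightarrow> T \<in> A \<Longrightarrow> P (S + T) = P S + P T"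
  and P_op_scale: "T \<in> A \<Longrightarrow> P (op_scale c T) = op_scale c (P T)"
  using proj by (auto simp: linear_projection_on_def)

lemma P_scaleR: "T \<in> A \<Longrightarrow> P (r *\<^sub>R T) = r *\<^sub>R P T"
  using P_op_scale[of T "complex_of_real r"] by (simp add: op_scale_of_real)

lemma P_0: "P 0 = 0"
  using P_scaleR[of 0 0] by simp

lemma P_diff: "S \<in> A \<Longrightarrow> T \<in> A \<Longrightarrow> P (S - T) = P S - P T"
  using P_add[of S "(-1) *\<^sub>R T"] P_scaleR[of T "-1"] A_scaleR[of T "-1"] by simp

lemma P_minus: "T \<in> A \<Longrightarrow> P (- T) = - P T"
  using P_scaleR[of T "-1"] by simp

lemma range_iff: "T \<in> P ` A \<longleftrightarrow> T \<in> A \<and> P T = T"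
  using P_in P_idem by (metis (no_types, opaque_lifting) imageE image_eqI)

lemma subspace_range: "op_vs.subspace (P ` A)"
proof -
  have sub: "op_vs.subspace A" using subalgebra_A by (simp add: op_subalgebra_def)
  show ?thesis
    unfolding op_vs.subspace_def range_iff
    using op_vs.subspace_0[OF sub] op_vs.subspace_add[OF sub] op_vs.subspace_scale[OF sub]
    by (auto simp: P_0 P_add P_op_scale P_in P_idem)
qed

lemmas A_intros = A_minus A_add A_diff A_scaleR A_compose P_in
lemmas P_linear = P_0 P_minus P_add P_diff P_scaleR unit

section \<open>Products of the range with the kernel\<close>

text \<open>One round of the Moebius argument. With \<open>z = P(y x)\<close>, take the matrix \<open>N\<close> of size four with entries
\<open>y\<close>, \<open>b z\<close> at \<open>(0,1)\<close>, \<open>(0,2)\<close> and \<open>x\<close> at \<open>(1,3)\<close>. The only entry of \<open>N\<^sup>2\<close> is \<open>y x\<close> at \<open>(0,3)\<close>, which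
\<open>P\<close> turns into \<open>z\<close>, so the row \<open>[y, b z]\<close> grows to \<open>[y, b z, z/2]\<close>. A rotation of the last two columns
merges them into one and keeps the size of the matrix fixed.\<close>

lemma row_contraction_step:
  assumes cc: "completely_contractive_on A P"
    and y: "y \<in> A" "P y = y" and x: "x \<in> A" "P x = 0" "norm x \<le> 1"
    and row: "\<And>h k. (norm (y h + b *\<^sub>R P (y o\<^sub>L x) k))\<^sup>2 \<le> (norm h)\<^sup>2 + (norm k)\<^sup>2"
  shows "(norm (y h + sqrt (b\<^sup>2 + 1/4) *\<^sub>R P (y o\<^sub>L x) k))\<^sup>2 \<le> (norm h)\<^sup>2 + (norm k)\<^sup>2"
proof -
  define z where "z = P (y o\<^sub>L x)"
  have z: "z \<in> A" "P z = z" using x y by (simp_all add: z_def A_intros P_idem)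
  have zdef: "P (y o\<^sub>L x) = z" by (simp add: z_def)
  \<comment> \<open>The Moebius transform \<open>-e + (1 - e\<^sup>2)(N + e N\<^sup>2)\<close> for \<open>e = 1/2\<close>.\<close>
  define G :: "nat \<Rightarrow> nat \<Rightarrow> ('h \<Rightarrow>\<^sub>L 'h)" where
    "G i j = (if i = j then (-1/2) *\<^sub>R id_blinfun
      else if i = 0 \<and> j = 1 then (3/4) *\<^sub>R y
      else if i = 0 \<and> j = 2 then (3/4 * b) *\<^sub>R z
      else if i = 1 \<and> j = 3 then (3/4) *\<^sub>R x
      else if i = 0 \<and> j = 3 then (3/8) *\<^sub>R (y o\<^sub>L x) else 0)" for i j
  have GA: "G i j \<in> A" for i j
    using x y z by (simp add: G_def A_intros)
  have "mat_contraction 4 G"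
    unfolding mat_contraction_def
  proof
    fix u :: "nat \<Rightarrow> 'h"
    \<comment> \<open>\<open>v = (1 - N/2)\<^sup>-\<^sup>1 u\<close> and \<open>w = N v\<close>, so that \<open>G u = w - v/2\<close> and \<open>u = v - w/2\<close>.\<close>
    define v1 where "v1 = u 1 + (1/2) *\<^sub>R x (u 3)"
    define r where "r = y v1 + b *\<^sub>R z (u 2)"
    define v where "v = (\<lambda>i::nat. if i = 0 then u 0 + (1/2) *\<^sub>R r else if i = 1 then v1 else u i)"
    define w where "w = (\<lambda>i::nat. if i = 0 then r else if i = 1 then x (u 3) else 0)"
    have "(norm (x (u 3)))\<^sup>2 \<le> (norm (u 3))\<^sup>2"
      using norm_blinfun[of x "u 3"] x(3) mult_right_mono[of "norm x" 1 "norm (u 3)"]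
      by (intro power_mono) auto
    moreover have "(norm r)\<^sup>2 \<le> (norm v1)\<^sup>2 + (norm (u 2))\<^sup>2"
      using row[of v1 "u 2"] by (simp add: r_def z_def)
    moreover have "(\<Sum>i<4. (norm (w i))\<^sup>2) = (norm r)\<^sup>2 + (norm (x (u 3)))\<^sup>2"
      by (simp add: sum_lessThan_4 w_def)
    moreover have "(\<Sum>i<4. (norm (v i))\<^sup>2)
        = (norm (u 0 + (1/2) *\<^sub>R r))\<^sup>2 + (norm v1)\<^sup>2 + (norm (u 2))\<^sup>2 + (norm (u 3))\<^sup>2"
      by (simp add: sum_lessThan_4 v_def)
    ultimately have "(\<Sum>i<4. (norm (w i))\<^sup>2) \<le> (\<Sum>i<4. (norm (v i))\<^sup>2)"
      using zero_le_power2[of "norm (u 0 + (1/2) *\<^sub>R r)"] by linarith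
    then have le: "(\<Sum>i<4. (norm (w i - (1/2) *\<^sub>R v i))\<^sup>2) \<le> (\<Sum>i<4. (norm (v i - (1/2) *\<^sub>R w i))\<^sup>2)"
      by (intro mobius_contraction) (auto simp: power2_eq_square)
    have "(\<Sum>i<4. (norm (w i - (1/2) *\<^sub>R v i))\<^sup>2) = (\<Sum>i<4. (norm (\<Sum>j<4. G i j (u j)))\<^sup>2)"
    proof (intro sum.cong refl)
      fix i :: nat assume "i \<in> {..<4}"
      then consider "i = 0" | "i = 1" | "i = 2" | "i = 3" by force
      then have "w i - (1/2) *\<^sub>R v i = (\<Sum>j<4. G i j (u j))"
      proof cases
        case 1
        have "w i - (1/2) *\<^sub>R v i = (r - (1/4) *\<^sub>R r) - (1/2) *\<^sub>R u 0"
          using 1 by (simp add: w_def v_def scaleR_add_right)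
        also have "r - (1/4) *\<^sub>R r = (3/4) *\<^sub>R r"
          by (simp add: algebra_simps flip: scaleR_add_left)
        also have "\<dots> = (3/4) *\<^sub>R y (u 1) + (3/8) *\<^sub>R y (x (u 3)) + (3/4*b) *\<^sub>R z (u 2)"
          by (simp add: r_def v1_def blinfun.add_right blinfun.scaleR_right scaleR_add_right)
        finally show ?thesis using 1
          by (simp add: sum_lessThan_4 G_def blinfun.scaleR_left blinfun.minus_left)
      next
        case 2
        have "(3/4::real) *\<^sub>R x (u 3) = x (u 3) - (1/4) *\<^sub>R x (u 3)"
          by (simp add: algebra_simps flip: scaleR_add_left)
        then show ?thesis using 2
          by (simp add: sum_lessThan_4 G_def v_def w_def v1_def blinfun.scaleR_left blinfun.minus_left scaleR_add_right)
      qed (simp_all add: sum_lessThan_4 G_def v_def w_def blinfun.scaleR_left blinfun.minus_left)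
      then show "(norm (w i - (1/2) *\<^sub>R v i))\<^sup>2 = (norm (\<Sum>j<4. G i j (u j)))\<^sup>2" by simp
    qed
    moreover have "(\<Sum>i<4. (norm (v i - (1/2) *\<^sub>R w i))\<^sup>2) = (\<Sum>i<4. (norm (u i))\<^sup>2)"
      by (simp add: sum_lessThan_4 v_def w_def v1_def)
    ultimately show "(\<Sum>i<4. (norm (\<Sum>j<4. G i j (u j)))\<^sup>2) \<le> (\<Sum>i<4. (norm (u i))\<^sup>2)"
      using le by simp
  qed
  then have PG: "mat_contraction 4 (\<lambda>i j. P (G i j))"
    using completely_contractive_on_contraction[OF cc, of 4 G] GA by simp
  have three: "(norm (y h + b *\<^sub>R z k + (1/2) *\<^sub>R z l))\<^sup>2 \<le> (norm h)\<^sup>2 + (norm k)\<^sup>2 + (norm l)\<^sup>2" for h k l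
  proof -
    define r where "r = y h + b *\<^sub>R z k + (1/2) *\<^sub>R z l"
    \<comment> \<open>The first component \<open>-r/2\<close> is the one that gives the best bound on \<open>r\<close>.\<close>
    define u where "u = (\<lambda>i::nat. if i = 0 then (-1/2) *\<^sub>R r else if i = 1 then h else if i = 2 then k else l)"
    have PGs: "P (G 0 0) = (-1/2) *\<^sub>R id_blinfun" "P (G 1 1) = (-1/2) *\<^sub>R id_blinfun"
      "P (G 2 2) = (-1/2) *\<^sub>R id_blinfun" "P (G 3 3) = (-1/2) *\<^sub>R id_blinfun"
      "P (G 0 1) = (3/4) *\<^sub>R y" "P (G 0 2) = (3/4 * b) *\<^sub>R z" "P (G 0 3) = (3/8) *\<^sub>R z"
      "P (G 1 3) = 0" "P (G 1 0) = 0" "P (G 1 2) = 0" "P (G 2 0) = 0" "P (G 2 1) = 0"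
      "P (G 2 3) = 0" "P (G 3 0) = 0" "P (G 3 1) = 0" "P (G 3 2) = 0"
      unfolding G_def using x y z by (simp_all add: P_linear A_intros zdef)
    have q: "(norm (a *\<^sub>R s))\<^sup>2 = a\<^sup>2 * (norm s)\<^sup>2" for a and s :: 'h
      by (simp add: power_mult_distrib)
    have "(\<Sum>j<4. P (G 0 j) (u j)) = r"
    proof -
      have "(\<Sum>j<4. P (G 0 j) (u j)) = (1/4) *\<^sub>R r + (3/4) *\<^sub>R r"
        unfolding sum_lessThan_4 PGs
        by (simp add: u_def blinfun.scaleR_left blinfun.minus_left r_def scaleR_add_right scaleR_diff_right)
      then show ?thesis by (simp flip: scaleR_add_left)
    qed
    moreover have "(\<Sum>j<4. P (G 1 j) (u j)) = (-1/2) *\<^sub>R h"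
      "(\<Sum>j<4. P (G 2 j) (u j)) = (-1/2) *\<^sub>R k" "(\<Sum>j<4. P (G 3 j) (u j)) = (-1/2) *\<^sub>R l"
      unfolding sum_lessThan_4 PGs by (simp_all add: u_def blinfun.scaleR_left blinfun.minus_left)
    ultimately have "(norm r)\<^sup>2 + (norm h)\<^sup>2/4 + (norm k)\<^sup>2/4 + (norm l)\<^sup>2/4
        \<le> (norm r)\<^sup>2/4 + (norm h)\<^sup>2 + (norm k)\<^sup>2 + (norm l)\<^sup>2"
      using PG[unfolded mat_contraction_def, rule_format, of u]
      unfolding sum_lessThan_4[of "\<lambda>i. (norm (_ i))\<^sup>2"]
      by (simp add: q u_def power2_eq_square)
    then show ?thesis by (simp add: r_def)
  qed
  define s where "s = sqrt (b\<^sup>2 + 1/4)"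
  have s2: "s\<^sup>2 = b\<^sup>2 + 1/4" by (simp add: s_def)
  have s0: "s > 0" unfolding s_def by (simp add: add_nonneg_pos)
  \<comment> \<open>The vector \<open>k\<close> is split between the two columns in the proportion \<open>b : 1/2\<close>.\<close>
  have "y h + b *\<^sub>R z ((b/s) *\<^sub>R k) + (1/2) *\<^sub>R z ((1/2/s) *\<^sub>R k) = y h + ((b\<^sup>2 + 1/4)/s) *\<^sub>R z k"
    by (simp add: blinfun.scaleR_right power2_eq_square add_divide_distrib scaleR_add_left)
  also have "(b\<^sup>2 + 1/4)/s = s" using s0 s2 by (simp add: field_simps power2_eq_square)
  finally have eq: "y h + b *\<^sub>R z ((b/s) *\<^sub>R k) + (1/2) *\<^sub>R z ((1/2/s) *\<^sub>R k) = y h + s *\<^sub>R z k" .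
  have "(norm (y h + s *\<^sub>R z k))\<^sup>2
      \<le> (norm h)\<^sup>2 + (norm ((b/s) *\<^sub>R k))\<^sup>2 + (norm ((1/2/s) *\<^sub>R k))\<^sup>2"
    using three[of h "(b/s) *\<^sub>R k" "(1/2/s) *\<^sub>R k"] unfolding eq .
  also have "\<dots> = (norm h)\<^sup>2 + ((norm ((b/s) *\<^sub>R k))\<^sup>2 + (norm ((1/2/s) *\<^sub>R k))\<^sup>2)"
    by simp
  also have "(norm ((b/s) *\<^sub>R k))\<^sup>2 + (norm ((1/2/s) *\<^sub>R k))\<^sup>2 = ((b/s)\<^sup>2 + (1/2/s)\<^sup>2) * (norm k)\<^sup>2"
    by (simp add: power_mult_distrib distrib_right power_divide)
  also have "(b/s)\<^sup>2 + (1/2/s)\<^sup>2 = (b\<^sup>2 + 1/4) / s\<^sup>2"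
    by (simp add: power_divide add_divide_distrib power2_eq_square)
  also have "\<dots> = 1" using s0 by (simp flip: s2)
  finally show ?thesis by (simp add: s_def z_def)
qed

lemma range_times_kernel_contractions:
  assumes cc: "completely_contractive_on A P"
    and y: "y \<in> A" "P y = y" "norm y \<le> 1" and x: "x \<in> A" "P x = 0" "norm x \<le> 1"
  shows "P (y o\<^sub>L x) = 0"
proof -
  define z where "z = P (y o\<^sub>L x)"
  have row: "(norm (y h + sqrt (real m / 4) *\<^sub>R z k))\<^sup>2 \<le> (norm h)\<^sup>2 + (norm k)\<^sup>2" for m h k
  proof (induction m arbitrary: h k)
    case 0
    have "(norm (y h))\<^sup>2 \<le> (norm h)\<^sup>2"
      using norm_apply_le_if_norm_le_1[OF y(3)] by (intro power_mono) auto
    then show ?case by (simp add: add_increasing2)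
  next
    case (Suc m)
    have "real (Suc m) / 4 = (sqrt (real m / 4))\<^sup>2 + 1/4" by simp
    then show ?case
      using row_contraction_step[OF cc y(1,2) x Suc[unfolded z_def], of h k] by (simp only: z_def)
  qed
  have "z k = 0" for k
  proof (rule eq_0_if_bounded_multiples)
    show "real m * (1/4) * (norm (z k))\<^sup>2 \<le> (norm k)\<^sup>2" for m
      using row[of 0 m k] by (simp add: power_mult_distrib)
  qed simp
  then show ?thesis by (intro blinfun_eqI) (simp add: z_def)
qed

lemma range_times_kernel:
  assumes cc: "completely_contractive_on A P"
    and y: "y \<in> A" "P y = y" and x: "x \<in> A" "P x = 0"
  shows "P (y o\<^sub>L x) = 0"
proof -
  obtain r where r: "r > 0" "norm (r *\<^sub>R y) \<le> 1" by (rule exists_normalising_scalar)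
  obtain s where s: "s > 0" "norm (s *\<^sub>R x) \<le> 1" by (rule exists_normalising_scalar)
  have "P ((r *\<^sub>R y) o\<^sub>L (s *\<^sub>R x)) = 0"
    using r s x y by (intro range_times_kernel_contractions[OF cc]) (simp_all add: A_intros P_linear)
  moreover have "(r *\<^sub>R y) o\<^sub>L (s *\<^sub>R x) = (r * s) *\<^sub>R (y o\<^sub>L x)"
    by (rule blinfun_eqI) (simp add: blinfun.scaleR_left blinfun.scaleR_right)
  ultimately show ?thesis using r s x y by (simp add: P_scaleR A_compose)
qed

section \<open>Products within the kernel\<close>

text \<open>One round of the Moebius argument for \<open>Q\<close>, with the matrix \<open>N\<close> of size three with entries \<open>c\<close>, \<open>u\<close> at
\<open>(0,1)\<close>, \<open>(0,2)\<close> and \<open>c'\<close> at \<open>(1,2)\<close>. The map \<open>Q\<close> kills the diagonal and replaces the entry \<open>c c'\<close> of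
\<open>N\<^sup>2\<close> by \<open>w\<close>; the result has the same shape as \<open>N\<close>, with a new corner.\<close>

lemma kernel_contraction_step:
  assumes cc: "completely_contractive_on A (\<lambda>T. T - P T)"
    and c: "c \<in> A" "P c = 0" and c': "c' \<in> A" "P c' = 0" and u: "u \<in> A" "P u = 0"
    and e: "e\<^sup>2 \<le> 1"
    and contr: "\<And>h k. (norm (c h + u k))\<^sup>2 + (norm (c' k))\<^sup>2 \<le> (norm h)\<^sup>2 + (norm k)\<^sup>2"
    and w: "w = (c o\<^sub>L c') - P (c o\<^sub>L c')" and d: "d = 1 - e\<^sup>2"
  shows "(norm (d *\<^sub>R c h + d *\<^sub>R (u k + e *\<^sub>R w k)))\<^sup>2 + (norm (d *\<^sub>R c' k))\<^sup>2 \<le> (norm h)\<^sup>2 + (norm k)\<^sup>2"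
proof -
  define G :: "nat \<Rightarrow> nat \<Rightarrow> ('h \<Rightarrow>\<^sub>L 'h)" where
    "G i j = (if i = j then (-e) *\<^sub>R id_blinfun
      else if i = 0 \<and> j = 1 then d *\<^sub>R c
      else if i = 1 \<and> j = 2 then d *\<^sub>R c'
      else if i = 0 \<and> j = 2 then d *\<^sub>R u + (d * e) *\<^sub>R (c o\<^sub>L c') else 0)" for i j
  have GA: "G i j \<in> A" for i j
    using c c' u by (simp add: G_def A_intros)
  have "mat_contraction 3 G"
    unfolding mat_contraction_def
  proof
    fix t :: "nat \<Rightarrow> 'h"
    \<comment> \<open>\<open>v = (1 - e N)\<^sup>-\<^sup>1 t\<close> and \<open>w = N v\<close>, so that \<open>G t = w - e v\<close> and \<open>t = v - e w\<close>.\<close>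
    define v1 where "v1 = t 1 + e *\<^sub>R c' (t 2)"
    define r where "r = c v1 + u (t 2)"
    define v where "v = (\<lambda>i::nat. if i = 0 then t 0 + e *\<^sub>R r else if i = 1 then v1 else t i)"
    define w where "w = (\<lambda>i::nat. if i = 0 then r else if i = 1 then c' (t 2) else 0)"
    have "(\<Sum>i<3. (norm (w i))\<^sup>2) = (norm r)\<^sup>2 + (norm (c' (t 2)))\<^sup>2"
      by (simp add: sum_lessThan_3 w_def)
    moreover have "(\<Sum>i<3. (norm (v i))\<^sup>2)
        = (norm (t 0 + e *\<^sub>R r))\<^sup>2 + (norm v1)\<^sup>2 + (norm (t 2))\<^sup>2"
      by (simp add: sum_lessThan_3 v_def)
    ultimately have "(\<Sum>i<3. (norm (w i))\<^sup>2) \<le> (\<Sum>i<3. (norm (v i))\<^sup>2)"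
      using contr[of v1 "t 2", folded r_def] zero_le_power2[of "norm (t 0 + e *\<^sub>R r)"] by linarith
    then have le: "(\<Sum>i<3. (norm (w i - e *\<^sub>R v i))\<^sup>2) \<le> (\<Sum>i<3. (norm (v i - e *\<^sub>R w i))\<^sup>2)"
      using e by (rule mobius_contraction)
    have "(\<Sum>i<3. (norm (w i - e *\<^sub>R v i))\<^sup>2) = (\<Sum>i<3. (norm (\<Sum>j<3. G i j (t j)))\<^sup>2)"
    proof (intro sum.cong refl)
      fix i :: nat assume "i \<in> {..<3}"
      then consider "i = 0" | "i = 1" | "i = 2" by force
      then have "w i - e *\<^sub>R v i = (\<Sum>j<3. G i j (t j))"
      proof cases
        case 1
        have "w i - e *\<^sub>R v i = (r - (e * e) *\<^sub>R r) - e *\<^sub>R t 0"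
          using 1 by (simp add: w_def v_def scaleR_add_right)
        also have "r - (e * e) *\<^sub>R r = d *\<^sub>R r"
          by (simp add: d power2_eq_square scaleR_diff_left)
        also have "\<dots> = d *\<^sub>R c (t 1) + (d * e) *\<^sub>R c (c' (t 2)) + d *\<^sub>R u (t 2)"
          by (simp add: r_def v1_def blinfun.add_right blinfun.scaleR_right scaleR_add_right)
        finally show ?thesis using 1
          by (simp add: sum_lessThan_3 G_def blinfun.scaleR_left blinfun.minus_left blinfun.add_left)
      next
        case 2
        have "d *\<^sub>R c' (t 2) = c' (t 2) - (e * e) *\<^sub>R c' (t 2)"
          by (simp add: d power2_eq_square scaleR_diff_left)
        then show ?thesis using 2
          by (simp add: sum_lessThan_3 G_def v_def w_def v1_def blinfun.scaleR_left blinfun.minus_left scaleR_add_right)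
      qed (simp_all add: sum_lessThan_3 G_def v_def w_def blinfun.scaleR_left blinfun.minus_left)
      then show "(norm (w i - e *\<^sub>R v i))\<^sup>2 = (norm (\<Sum>j<3. G i j (t j)))\<^sup>2" by simp
    qed
    moreover have "(\<Sum>i<3. (norm (v i - e *\<^sub>R w i))\<^sup>2) = (\<Sum>i<3. (norm (t i))\<^sup>2)"
      by (simp add: sum_lessThan_3 v_def w_def v1_def)
    ultimately show "(\<Sum>i<3. (norm (\<Sum>j<3. G i j (t j)))\<^sup>2) \<le> (\<Sum>i<3. (norm (t i))\<^sup>2)"
      using le by simp
  qed
  then have QG: "mat_contraction 3 (\<lambda>i j. G i j - P (G i j))"
    using completely_contractive_on_contraction[OF cc, of 3 G] GA by simp
  define t where "t = (\<lambda>i::nat. if i = 0 then 0 else if i = 1 then h else k)"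
  define H where "H = (\<lambda>i j. G i j - P (G i j))"
  have H: "mat_contraction 3 H" using QG unfolding H_def .
  have Hs: "H 0 0 = 0" "H 1 1 = 0" "H 2 2 = 0" "H 0 1 = d *\<^sub>R c" "H 1 2 = d *\<^sub>R c'"
    "H 0 2 = d *\<^sub>R u + (d * e) *\<^sub>R w" "H 1 0 = 0" "H 2 0 = 0" "H 2 1 = 0"
    unfolding G_def H_def w using c c' u by (simp_all add: P_linear A_intros scaleR_diff_right)
  show ?thesis
    using H[unfolded mat_contraction_def, rule_format, of t]
    unfolding sum_lessThan_3 Hs
    by (simp add: t_def blinfun.scaleR_left blinfun.add_left scaleR_add_right add.assoc)
qed

text \<open>After \<open>m\<close> rounds the entries \<open>c\<close> and \<open>c'\<close> carry the factor \<open>(1 - e\<^sup>2)\<^sup>m\<close> and the corner is at least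
\<open>m e (1 - e\<^sup>2)\<^sup>2\<^sup>m\<close> times \<open>w\<close>. For \<open>m = k\<^sup>2\<close> and \<open>e = 1/(2 k)\<close> the power of \<open>1 - e\<^sup>2\<close> stays away from zero
by Bernoulli's inequality, while \<open>m e = k/2\<close> grows without bound.\<close>

lemma kernel_times_kernel_contractions:
  assumes cc: "completely_contractive_on A (\<lambda>T. T - P T)"
    and c: "c \<in> A" "P c = 0" "norm c \<le> 1" and c': "c' \<in> A" "P c' = 0" "norm c' \<le> 1"
  shows "P (c o\<^sub>L c') = c o\<^sub>L c'"
proof -
  define w where "w = (c o\<^sub>L c') - P (c o\<^sub>L c')"
  have "c o\<^sub>L c' \<in> A" using c c' by (simp add: A_compose)
  then have wA: "w \<in> A" "P w = 0" by (simp_all add: w_def A_diff P_diff P_in P_idem)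
  have iter: "\<exists>b \<ge> real m * e * (d ^ m)\<^sup>2. \<forall>h k.
      (norm (d ^ m *\<^sub>R c h + b *\<^sub>R w k))\<^sup>2 + (norm (d ^ m *\<^sub>R c' k))\<^sup>2 \<le> (norm h)\<^sup>2 + (norm k)\<^sup>2"
    if e: "0 \<le> e" "e\<^sup>2 \<le> 1" and d: "d = 1 - e\<^sup>2" for e d m
  proof (induction m)
    case 0
    have "(norm (c h))\<^sup>2 + (norm (c' k))\<^sup>2 \<le> (norm h)\<^sup>2 + (norm k)\<^sup>2" for h k
      using norm_apply_le_if_norm_le_1[OF c(3)] norm_apply_le_if_norm_le_1[OF c'(3)] by (intro add_mono power_mono) auto
    then show ?case by (intro exI[of _ 0]) simp
  next
    case (Suc m)
    then obtain b where b: "b \<ge> real m * e * (d ^ m)\<^sup>2"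
      and contr: "\<And>h k. (norm (d ^ m *\<^sub>R c h + b *\<^sub>R w k))\<^sup>2 + (norm (d ^ m *\<^sub>R c' k))\<^sup>2
        \<le> (norm h)\<^sup>2 + (norm k)\<^sup>2" by blast
    have d01: "0 \<le> d" "d \<le> 1" using e d by auto
    have w': "(d ^ m)\<^sup>2 *\<^sub>R w = ((d ^ m *\<^sub>R c) o\<^sub>L (d ^ m *\<^sub>R c')) - P ((d ^ m *\<^sub>R c) o\<^sub>L (d ^ m *\<^sub>R c'))"
    proof -
      have "(d ^ m *\<^sub>R c) o\<^sub>L (d ^ m *\<^sub>R c') = (d ^ m)\<^sup>2 *\<^sub>R (c o\<^sub>L c')"
        by (rule blinfun_eqI) (simp add: blinfun.scaleR_left blinfun.scaleR_right power2_eq_square)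
      then show ?thesis using c c' by (simp add: w_def P_scaleR A_compose scaleR_diff_right)
    qed
    define b' where "b' = d * (b + e * (d ^ m)\<^sup>2)"
    have "(norm (d ^ Suc m *\<^sub>R c h + b' *\<^sub>R w k))\<^sup>2 + (norm (d ^ Suc m *\<^sub>R c' k))\<^sup>2
        \<le> (norm h)\<^sup>2 + (norm k)\<^sup>2" for h k
    proof -
      have "(norm (d *\<^sub>R (d ^ m *\<^sub>R c) h + d *\<^sub>R ((b *\<^sub>R w) k + e *\<^sub>R ((d ^ m)\<^sup>2 *\<^sub>R w) k)))\<^sup>2
          + (norm (d *\<^sub>R (d ^ m *\<^sub>R c') k))\<^sup>2 \<le> (norm h)\<^sup>2 + (norm k)\<^sup>2"
      proof (rule kernel_contraction_step[OF cc _ _ _ _ _ _ e(2) _ w' d])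
        show "(norm ((d ^ m *\<^sub>R c) h + (b *\<^sub>R w) k))\<^sup>2 + (norm ((d ^ m *\<^sub>R c') k))\<^sup>2
          \<le> (norm h)\<^sup>2 + (norm k)\<^sup>2" for h k
          using contr by (simp add: blinfun.scaleR_left)
      qed (use c c' wA in \<open>simp_all add: A_intros P_linear\<close>)
      moreover have "d *\<^sub>R (d ^ m *\<^sub>R c) h + d *\<^sub>R ((b *\<^sub>R w) k + e *\<^sub>R ((d ^ m)\<^sup>2 *\<^sub>R w) k)
          = d ^ Suc m *\<^sub>R c h + b' *\<^sub>R w k"
        by (simp add: blinfun.scaleR_left b'_def scaleR_add_right scaleR_add_left distrib_left)
      ultimately show ?thesis by (simp add: blinfun.scaleR_left)
    qed
    moreover have "real (Suc m) * e * (d ^ Suc m)\<^sup>2 \<le> b'"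
    proof -
      have "real (Suc m) * e * (d ^ Suc m)\<^sup>2 = d * (d * (real (Suc m) * e * (d ^ m)\<^sup>2))"
        by (simp add: power2_eq_square)
      also have "\<dots> \<le> d * (1 * (real (Suc m) * e * (d ^ m)\<^sup>2))"
        using d01 e by (intro mult_left_mono mult_right_mono) auto
      also have "\<dots> \<le> b'"
        unfolding b'_def using d01 b by (intro mult_left_mono) (auto simp: algebra_simps)
      finally show ?thesis .
    qed
    ultimately show ?case by (intro exI[of _ b']) blast
  qed
  have bound: "real k * (1/8) * norm (w x) \<le> norm x" for k x
  proof (cases "k = 0")
    case False
    define e where "e = 1 / (2 * real k)"
    define d where "d = 1 - e\<^sup>2"
    have k1: "real k \<ge> 1" using False by simp
    have e: "0 \<le> e" "e \<le> 1" using k1 by (simp_all add: e_def)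
    then have e2: "e\<^sup>2 \<le> 1" by (simp add: power_le_one)
    obtain b where b: "b \<ge> real (k\<^sup>2) * e * (d ^ k\<^sup>2)\<^sup>2"
      and contr: "\<And>h l. (norm (d ^ k\<^sup>2 *\<^sub>R c h + b *\<^sub>R w l))\<^sup>2 + (norm (d ^ k\<^sup>2 *\<^sub>R c' l))\<^sup>2
        \<le> (norm h)\<^sup>2 + (norm l)\<^sup>2"
      using iter[OF e(1) e2 d_def, of "k\<^sup>2"] by blast
    have "1 + real (k\<^sup>2) * (- e\<^sup>2) \<le> (1 + (- e\<^sup>2)) ^ k\<^sup>2"
      using e2 by (intro Bernoulli_inequality) simp
    moreover have "real (k\<^sup>2) * e\<^sup>2 = 1/4"
      using k1 by (simp add: e_def power_divide power_mult_distrib)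
    ultimately have "3/4 \<le> d ^ k\<^sup>2" by (simp add: d_def)
    then have "(3/4)\<^sup>2 \<le> (d ^ k\<^sup>2)\<^sup>2" by (intro power_mono) auto
    then have "1/4 \<le> (d ^ k\<^sup>2)\<^sup>2" by (simp add: power2_eq_square)
    then have "real (k\<^sup>2) * e * (1/4) \<le> real (k\<^sup>2) * e * (d ^ k\<^sup>2)\<^sup>2"
      using e by (intro mult_left_mono) auto
    moreover have "real (k\<^sup>2) * e = real k / 2"
      using k1 by (simp add: e_def power2_eq_square)
    ultimately have kb: "real k * (1/8) \<le> b" using b by simp
    have contr_x: "(norm (b *\<^sub>R w x))\<^sup>2 + (norm (d ^ k\<^sup>2 *\<^sub>R c' x))\<^sup>2 \<le> (norm x)\<^sup>2"
      using contr[of 0 x] by (simp add: blinfun.zero_right)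
    have "(norm (b *\<^sub>R w x))\<^sup>2 \<le> (norm x)\<^sup>2"
      using contr_x zero_le_power2[of "norm (d ^ k\<^sup>2 *\<^sub>R c' x)"] by linarith
    then have "norm (b *\<^sub>R w x) \<le> norm x" by (rule power2_le_imp_le) simp
    then have "\<bar>b\<bar> * norm (w x) \<le> norm x" by simp
    moreover have "real k * (1/8) * norm (w x) \<le> \<bar>b\<bar> * norm (w x)"
      using kb by (intro mult_right_mono) auto
    ultimately show ?thesis by linarith
  qed simp
  have "w x = 0" for x
  proof (rule eq_0_if_bounded_multiples[where c = "1/8"])
    show "real k * (1/8) * (norm (w x))\<^sup>2 \<le> norm x * norm (w x)" for k
      using mult_right_mono[OF bound[of k x] norm_ge_zero[of "w x"]] by (simp add: power2_eq_square)
  qed simp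
  then have "w = 0" by (intro blinfun_eqI) simp
  then show ?thesis by (simp add: w_def)
qed

lemma kernel_times_kernel:
  assumes cc: "completely_contractive_on A (\<lambda>T. T - P T)"
    and c: "c \<in> A" "P c = 0" and c': "c' \<in> A" "P c' = 0"
  shows "P (c o\<^sub>L c') = c o\<^sub>L c'"
proof -
  obtain r where r: "r > 0" "norm (r *\<^sub>R c) \<le> 1" by (rule exists_normalising_scalar)
  obtain s where s: "s > 0" "norm (s *\<^sub>R c') \<le> 1" by (rule exists_normalising_scalar)
  have "P ((r *\<^sub>R c) o\<^sub>L (s *\<^sub>R c')) = (r *\<^sub>R c) o\<^sub>L (s *\<^sub>R c')"
    using r s c c' by (intro kernel_times_kernel_contractions[OF cc]) (simp_all add: A_intros P_linear)
  moreover have "(r *\<^sub>R c) o\<^sub>L (s *\<^sub>R c') = (r * s) *\<^sub>R (c o\<^sub>L c')"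
    by (rule blinfun_eqI) (simp add: blinfun.scaleR_left blinfun.scaleR_right)
  ultimately show ?thesis using r s c c' by (simp add: P_scaleR A_compose)
qed

end

section \<open>Square summable sequences in a Hilbert space\<close>

lemma summable_norm_square_add:
  fixes x y :: "nat \<Rightarrow> 'a::real_inner"
  assumes "summable (\<lambda>n. (norm (x n))\<^sup>2)" and "summable (\<lambda>n. (norm (y n))\<^sup>2)"
  shows "summable (\<lambda>n. (norm (x n + y n))\<^sup>2)"
proof (rule summable_comparison_test')
  show "summable (\<lambda>n. 2 * (norm (x n))\<^sup>2 + 2 * (norm (y n))\<^sup>2)"
    using assms by (intro summable_add summable_mult)
  show "norm ((norm (x n + y n))\<^sup>2) \<le> 2 * (norm (x n))\<^sup>2 + 2 * (norm (y n))\<^sup>2" if "n \<ge> 0" for n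
    using parallelogram_law[of "x n" "y n"] zero_le_power2[of "norm (x n - y n)"]
    unfolding real_norm_def abs_power2 by linarith
qed

lemma summable_inner:
  fixes x y :: "nat \<Rightarrow> 'a::real_inner"
  assumes "summable (\<lambda>n. (norm (x n))\<^sup>2)" and "summable (\<lambda>n. (norm (y n))\<^sup>2)"
  shows "summable (\<lambda>n. inner (x n) (y n))"
proof (rule summable_comparison_test')
  show "summable (\<lambda>n. (norm (x n))\<^sup>2 + (norm (y n))\<^sup>2)"
    using assms by (intro summable_add)
  show "norm (inner (x n) (y n)) \<le> (norm (x n))\<^sup>2 + (norm (y n))\<^sup>2" if "n \<ge> 0" for n
  proof -
    have "2 * (norm (x n) * norm (y n)) \<le> (norm (x n))\<^sup>2 + (norm (y n))\<^sup>2"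
      using sum_squares_bound[of "norm (x n)" "norm (y n)"] by simp
    moreover have "0 \<le> norm (x n) * norm (y n)" by simp
    ultimately show ?thesis
      using Cauchy_Schwarz_ineq2[of "x n" "y n"] unfolding real_norm_def by linarith
  qed
qed

text \<open>A normal functional is a vector functional of the operators \<open>T \<oplus> T \<oplus> ...\<close> on the countable direct sum
of copies of the Hilbert space. Weak* approximation thus becomes norm approximation in the direct sum,
where orthogonal projections are available.\<close>

typedef (overloaded) ('a::real_inner) ell2 = "{x :: nat \<Rightarrow> 'a. summable (\<lambda>n. (norm (x n))\<^sup>2)}"
  morphisms ell2_nth Abs_ell2
  by (rule exI[of _ "\<lambda>_. 0"]) simp

setup_lifting type_definition_ell2

lemma summable_ell2: "summable (\<lambda>n. (norm (ell2_nth x n))\<^sup>2)"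
  using ell2_nth[of x] by simp

lemma ell2_eqI: "(\<And>n. ell2_nth x n = ell2_nth y n) \<Longrightarrow> x = y"
  by (metis ell2_nth_inject ext)

instantiation ell2 :: (real_inner) real_inner
begin

lift_definition zero_ell2 :: "'a ell2" is "\<lambda>_. 0" by simp
lift_definition plus_ell2 :: "'a ell2 \<Rightarrow> 'a ell2 \<Rightarrow> 'a ell2" is "\<lambda>x y n. x n + y n"
  by (rule summable_norm_square_add)
lift_definition uminus_ell2 :: "'a ell2 \<Rightarrow> 'a ell2" is "\<lambda>x n. - x n" by simp
definition minus_ell2 :: "'a ell2 \<Rightarrow> 'a ell2 \<Rightarrow> 'a ell2" where "minus_ell2 x y = x + - y"
lift_definition scaleR_ell2 :: "real \<Rightarrow> 'a ell2 \<Rightarrow> 'a ell2" is "\<lambda>r x n. r *\<^sub>R x n"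
  by (simp add: power_mult_distrib summable_mult)
definition inner_ell2 :: "'a ell2 \<Rightarrow> 'a ell2 \<Rightarrow> real"
  where "inner_ell2 x y = (\<Sum>n. inner (ell2_nth x n) (ell2_nth y n))"
definition norm_ell2 :: "'a ell2 \<Rightarrow> real" where "norm_ell2 x = sqrt (inner x x)"
definition dist_ell2 :: "'a ell2 \<Rightarrow> 'a ell2 \<Rightarrow> real" where "dist_ell2 x y = norm (x - y)"
definition sgn_ell2 :: "'a ell2 \<Rightarrow> 'a ell2" where "sgn_ell2 x = inverse (norm x) *\<^sub>R x"
definition uniformity_ell2 :: "('a ell2 \<times> 'a ell2) filter"
  where "uniformity_ell2 = (INF e\<in>{0<..}. principal {(x, y). dist x y < e})"
definition open_ell2 :: "'a ell2 set \<Rightarrow> bool"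
  where "open_ell2 U \<longleftrightarrow> (\<forall>x\<in>U. \<forall>\<^sub>F (x', y) in uniformity. x' = x \<longrightarrow> y \<in> U)"

lemma summable_inner_ell2: "summable (\<lambda>n. inner (ell2_nth x n) (ell2_nth y n))"
  by (intro summable_inner summable_ell2)

instance
proof
  fix x y z :: "'a ell2" and r s :: real
  show "x + y + z = x + (y + z)" "x + y = y + x" "0 + x = x" "- x + x = 0"
    "r *\<^sub>R (x + y) = r *\<^sub>R x + r *\<^sub>R y" "(r + s) *\<^sub>R x = r *\<^sub>R x + s *\<^sub>R x"
    "r *\<^sub>R s *\<^sub>R x = (r * s) *\<^sub>R x" "1 *\<^sub>R x = x"
    by (transfer, simp add: algebra_simps)+
  show "x - y = x + - y" by (rule minus_ell2_def)
  show "dist x y = norm (x - y)" by (rule dist_ell2_def)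
  show "sgn x = inverse (norm x) *\<^sub>R x" by (rule sgn_ell2_def)
  show "uniformity = (INF e\<in>{0<..}. principal {(x :: 'a ell2, y). dist x y < e})"
    by (rule uniformity_ell2_def)
  show "open U \<longleftrightarrow> (\<forall>x\<in>U. \<forall>\<^sub>F (x', y) in uniformity. x' = x \<longrightarrow> y \<in> U)" for U :: "'a ell2 set"
    by (rule open_ell2_def)
  show "inner x y = inner y x" by (simp add: inner_ell2_def inner_commute)
  show "inner (x + y) z = inner x z + inner y z"
    by (simp add: inner_ell2_def plus_ell2.rep_eq inner_add_left suminf_add summable_inner_ell2)
  show "inner (r *\<^sub>R x) y = r * inner x y"
    by (simp add: inner_ell2_def scaleR_ell2.rep_eq suminf_mult summable_inner_ell2)
  show "0 \<le> inner x x" by (simp add: inner_ell2_def suminf_nonneg summable_inner_ell2)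
  show "inner x x = 0 \<longleftrightarrow> x = 0"
  proof
    assume "inner x x = 0"
    then have "\<forall>n. inner (ell2_nth x n) (ell2_nth x n) = 0"
      unfolding inner_ell2_def by (subst (asm) suminf_eq_zero_iff) (simp_all add: summable_inner_ell2)
    then show "x = 0" by (intro ell2_eqI) (simp add: zero_ell2.rep_eq)
  qed (simp add: inner_ell2_def zero_ell2.rep_eq)
  show "norm x = sqrt (inner x x)" by (rule norm_ell2_def)
qed

end

lemma ell2_nth_simps [simp]:
  "ell2_nth 0 n = 0" "ell2_nth (x + y) n = ell2_nth x n + ell2_nth y n"
  "ell2_nth (x - y) n = ell2_nth x n - ell2_nth y n" "ell2_nth (r *\<^sub>R x) n = r *\<^sub>R ell2_nth x n"
  by (simp_all add: zero_ell2.rep_eq plus_ell2.rep_eq scaleR_ell2.rep_eq)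
    (simp only: minus_ell2_def plus_ell2.rep_eq uminus_ell2.rep_eq diff_conv_add_uminus)

lemma norm_ell2_square: "(norm x)\<^sup>2 = (\<Sum>n. (norm (ell2_nth x n))\<^sup>2)"
  by (simp add: power2_norm_eq_inner inner_ell2_def)

lemma sum_le_norm_ell2_square: "(\<Sum>n<N. (norm (ell2_nth x n))\<^sup>2) \<le> (norm x)\<^sup>2"
  unfolding norm_ell2_square by (rule sum_le_suminf) (auto simp: summable_ell2)

lemma norm_ell2_nth_le: "norm (ell2_nth x n) \<le> norm x"
proof (rule power2_le_imp_le)
  have "(norm (ell2_nth x n))\<^sup>2 \<le> (\<Sum>i<Suc n. (norm (ell2_nth x i))\<^sup>2)"
    by (rule member_le_sum) auto
  also have "\<dots> \<le> (norm x)\<^sup>2" by (rule sum_le_norm_ell2_square)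
  finally show "(norm (ell2_nth x n))\<^sup>2 \<le> (norm x)\<^sup>2" .
qed simp

instance ell2 :: ("{real_inner, complete_space}") complete_space
proof
  fix X :: "nat \<Rightarrow> 'a ell2" assume X: "Cauchy X"
  have "Cauchy (\<lambda>m. ell2_nth (X m) n)" for n
  proof (rule metric_CauchyI)
    fix e :: real assume "e > 0"
    then obtain M where M: "\<forall>m\<ge>M. \<forall>k\<ge>M. dist (X m) (X k) < e"
      using metric_CauchyD[OF X] by blast
    have "dist (ell2_nth (X m) n) (ell2_nth (X k) n) \<le> dist (X m) (X k)" for m k
      using norm_ell2_nth_le[of "X m - X k" n] by (simp add: dist_norm)
    with M show "\<exists>M. \<forall>m\<ge>M. \<forall>k\<ge>M. dist (ell2_nth (X m) n) (ell2_nth (X k) n) < e"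
      by (meson le_less_trans)
  qed
  then have "\<forall>n. \<exists>z. (\<lambda>m. ell2_nth (X m) n) \<longlonglongrightarrow> z"
    by (simp add: Cauchy_convergent convergent_def[symmetric])
  then obtain z where z: "\<And>n. (\<lambda>m. ell2_nth (X m) n) \<longlonglongrightarrow> z n" by metis
  \<comment> \<open>The Cauchy estimate passes to the coordinatewise limit for finite partial sums.\<close>
  have tail: "\<exists>M. \<forall>m\<ge>M. \<forall>N. (\<Sum>n<N. (norm (ell2_nth (X m) n - z n))\<^sup>2) \<le> e\<^sup>2" if e: "e > 0" for e
  proof -
    obtain M where M: "\<forall>m\<ge>M. \<forall>k\<ge>M. dist (X m) (X k) < e"
      using metric_CauchyD[OF X e] by blast
    have "(\<Sum>n<N. (norm (ell2_nth (X m) n - z n))\<^sup>2) \<le> e\<^sup>2" if m: "m \<ge> M" for m N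
    proof (rule LIMSEQ_le_const2)
      show "(\<lambda>k. \<Sum>n<N. (norm (ell2_nth (X m) n - ell2_nth (X k) n))\<^sup>2)
          \<longlonglongrightarrow> (\<Sum>n<N. (norm (ell2_nth (X m) n - z n))\<^sup>2)"
        by (intro tendsto_intros z)
      have "(\<Sum>n<N. (norm (ell2_nth (X m) n - ell2_nth (X k) n))\<^sup>2) \<le> e\<^sup>2" if "k \<ge> M" for k
      proof -
        have "(\<Sum>n<N. (norm (ell2_nth (X m - X k) n))\<^sup>2) \<le> (norm (X m - X k))\<^sup>2"
          by (rule sum_le_norm_ell2_square)
        also have "\<dots> \<le> e\<^sup>2"
          using M m that by (intro power_mono) (auto simp: dist_norm less_imp_le)
        finally show ?thesis by simp
      qed
      then show "\<exists>K. \<forall>k\<ge>K. (\<Sum>n<N. (norm (ell2_nth (X m) n - ell2_nth (X k) n))\<^sup>2) \<le> e\<^sup>2" by blast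
    qed
    then show ?thesis by blast
  qed
  have diff: "summable (\<lambda>n. (norm (ell2_nth (X m) n - z n))\<^sup>2)
      \<and> (\<Sum>n. (norm (ell2_nth (X m) n - z n))\<^sup>2) \<le> e\<^sup>2"
    if "\<forall>N. (\<Sum>n<N. (norm (ell2_nth (X m) n - z n))\<^sup>2) \<le> e\<^sup>2" for m e
    using that by (auto intro!: suminf_le_const summableI_nonneg_bounded[where x = "e\<^sup>2"])
  obtain m where "\<forall>N. (\<Sum>n<N. (norm (ell2_nth (X m) n - z n))\<^sup>2) \<le> 1\<^sup>2"
    using tail[of 1] by auto
  then have "summable (\<lambda>n. (norm (ell2_nth (X m) n - z n))\<^sup>2)" using diff[of m 1] by blast
  then have "summable (\<lambda>n. (norm (ell2_nth (X m) n + - (ell2_nth (X m) n - z n)))\<^sup>2)"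
    by (intro summable_norm_square_add summable_ell2) (simp only: norm_minus_cancel)
  then have zs: "z \<in> {x. summable (\<lambda>n. (norm (x n))\<^sup>2)}" by simp
  have "X \<longlonglongrightarrow> Abs_ell2 z"
  proof (rule metric_LIMSEQ_I)
    fix e :: real assume e: "e > 0"
    then obtain M where M: "\<forall>m\<ge>M. \<forall>N. (\<Sum>n<N. (norm (ell2_nth (X m) n - z n))\<^sup>2) \<le> (e/2)\<^sup>2"
      using tail[of "e/2"] by auto
    have "dist (X m) (Abs_ell2 z) < e" if "m \<ge> M" for m
    proof -
      have "(norm (X m - Abs_ell2 z))\<^sup>2 = (\<Sum>n. (norm (ell2_nth (X m) n - z n))\<^sup>2)"
        by (simp add: norm_ell2_square Abs_ell2_inverse[OF zs])
      also have "\<dots> \<le> (e/2)\<^sup>2" using M diff that by blast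
      finally have "norm (X m - Abs_ell2 z) \<le> e/2" by (rule power2_le_imp_le) (use e in simp)
      then show ?thesis using e by (simp add: dist_norm)
    qed
    then show "\<exists>M. \<forall>m\<ge>M. dist (X m) (Abs_ell2 z) < e" by blast
  qed
  then show "convergent X" by (auto simp: convergent_def)
qed

lemma summable_blinfun_apply:
  fixes T :: "'a::real_inner \<Rightarrow>\<^sub>L 'b::real_inner"
  assumes "summable (\<lambda>n. (norm (x n))\<^sup>2)"
  shows "summable (\<lambda>n. (norm (blinfun_apply T (x n)))\<^sup>2)"
proof (rule summable_comparison_test')
  show "summable (\<lambda>n. (norm T)\<^sup>2 * (norm (x n))\<^sup>2)" using assms by (rule summable_mult)
  show "norm ((norm (T (x n)))\<^sup>2) \<le> (norm T)\<^sup>2 * (norm (x n))\<^sup>2" if "n \<ge> 0" for n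
    using power_mono[OF norm_blinfun[of T "x n"], of 2] by (simp add: power_mult_distrib)
qed

lift_definition ell2_map :: "('a::real_inner \<Rightarrow>\<^sub>L 'b::real_inner) \<Rightarrow> 'a ell2 \<Rightarrow> 'b ell2"
  is "\<lambda>T x n. blinfun_apply T (x n)"
  by (rule summable_blinfun_apply)

declare ell2_map.rep_eq [simp]

lemma bounded_linear_ell2_map: "bounded_linear (ell2_map T)"
proof (rule bounded_linear_intro[where K = "norm T"])
  fix x
  have "(norm (ell2_map T x))\<^sup>2 = (\<Sum>n. (norm (T (ell2_nth x n)))\<^sup>2)"
    by (simp add: norm_ell2_square)
  also have "\<dots> \<le> (\<Sum>n. (norm T)\<^sup>2 * (norm (ell2_nth x n))\<^sup>2)"
  proof (rule suminf_le)
    show "(norm (T (ell2_nth x n)))\<^sup>2 \<le> (norm T)\<^sup>2 * (norm (ell2_nth x n))\<^sup>2" for n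
      using power_mono[OF norm_blinfun[of T "ell2_nth x n"], of 2] by (simp add: power_mult_distrib)
  qed (intro summable_blinfun_apply summable_mult summable_ell2)+
  also have "\<dots> = (norm x * norm T)\<^sup>2"
    by (simp add: norm_ell2_square suminf_mult summable_ell2 power_mult_distrib)
  finally show "norm (ell2_map T x) \<le> norm x * norm T" by (rule power2_le_imp_le) simp
qed (auto intro!: ell2_eqI simp: blinfun.add_right blinfun.scaleR_right)

section \<open>Approximation in the sense of square summable families\<close>

lemma is_adjoint_inner: "is_adjoint T S \<Longrightarrow> inner (T x) y = inner x (S y)"
  by (simp add: is_adjoint_def inner_eq_Re_cinner)

lemma is_adjoint_sym: "is_adjoint T S \<Longrightarrow> is_adjoint S T"
  unfolding is_adjoint_def by (metis cinner_commute)

lemma is_adjoint_compose: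
  "is_adjoint S S' \<Longrightarrow> is_adjoint T T' \<Longrightarrow> is_adjoint (S o\<^sub>L T) (T' o\<^sub>L S')"
  by (simp add: is_adjoint_def)

lemma subspace_closure:
  fixes V :: "'a::real_normed_vector set"
  assumes V: "subspace V"
  shows "subspace (closure V)"
  unfolding subspace_def
proof (intro conjI ballI allI)
  show "0 \<in> closure V" using subspace_0[OF V] closure_subset by blast
next
  fix x y assume "x \<in> closure V" "y \<in> closure V"
  then obtain f g where "\<And>n. f n \<in> V" "f \<longlonglongrightarrow> x" "\<And>n. g n \<in> V" "g \<longlonglongrightarrow> y"
    by (auto simp: closure_sequential)
  then show "x + y \<in> closure V"
    unfolding closure_sequential using subspace_add[OF V]
    by (intro exI[of _ "\<lambda>n. f n + g n"]) (auto intro: tendsto_add)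
next
  fix r x assume "x \<in> closure V"
  then obtain f where "\<And>n. f n \<in> V" "f \<longlonglongrightarrow> x" by (auto simp: closure_sequential)
  then show "r *\<^sub>R x \<in> closure V"
    unfolding closure_sequential using subspace_scale[OF V]
    by (intro exI[of _ "\<lambda>n. r *\<^sub>R f n"]) (auto intro: tendsto_scaleR)
qed

text \<open>Let \<open>p\<close> be the projection of \<open>\<xi>\<close> to the closure of \<open>L \<xi>\<close>, a subspace that \<open>M\<close> leaves invariant. For
\<open>c\<close> in \<open>C\<close>, the vector \<open>c\<^sup>* c (\<xi> - p)\<close> lies in that closure, to which \<open>\<xi> - p\<close> is orthogonal, and so
\<open>c (\<xi> - p) = 0\<close>. Then \<open>T (\<xi> - p) = 0\<close> as well, and \<open>T \<xi> = T p\<close> lies in the closure of \<open>L \<xi>\<close>.\<close>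

lemma approximation_by_left_ideal:
  fixes M L C :: "('h::complex_hilbert \<Rightarrow>\<^sub>L 'h) set"
  assumes L: "subspace L" "\<And>S T. S \<in> M \<Longrightarrow> T \<in> L \<Longrightarrow> S o\<^sub>L T \<in> L"
    and star: "\<And>S. S \<in> M \<Longrightarrow> \<exists>S'\<in>M. is_adjoint S S'"
    and C: "C \<subseteq> L" "C \<subseteq> M"
    and T: "T \<in> M" "\<And>k. (\<forall>c\<in>C. c k = 0) \<Longrightarrow> T k = 0"
    and \<xi>: "summable (\<lambda>n. (norm (\<xi> n))\<^sup>2)" and "\<epsilon> > 0"
  shows "\<exists>S\<in>L. (\<Sum>n. (norm (blinfun_apply (S - T) (\<xi> n)))\<^sup>2) < \<epsilon>"
proof -
  define x where "x = Abs_ell2 \<xi>"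
  have nth: "ell2_nth x = \<xi>" using \<xi> by (simp add: x_def Abs_ell2_inverse)
  define V where "V = (\<lambda>S. ell2_map S x) ` L"
  have "subspace V"
    unfolding subspace_def
  proof (intro conjI ballI allI)
    have "0 = ell2_map 0 x" by (rule ell2_eqI) simp
    then show "0 \<in> V" unfolding V_def using subspace_0[OF L(1)] by (rule image_eqI)
  next
    fix v w assume "v \<in> V" "w \<in> V"
    then obtain R S where RS: "R \<in> L" "S \<in> L" and "v = ell2_map R x" "w = ell2_map S x"
      by (auto simp: V_def)
    then have "v + w = ell2_map (R + S) x" by (intro ell2_eqI) (simp add: blinfun.add_left)
    then show "v + w \<in> V" unfolding V_def using subspace_add[OF L(1) RS] by (rule image_eqI)
  next
    fix r v assume "v \<in> V"
    then obtain R where R: "R \<in> L" and "v = ell2_map R x" by (auto simp: V_def)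
    then have "r *\<^sub>R v = ell2_map (r *\<^sub>R R) x" by (intro ell2_eqI) (simp add: blinfun.scaleR_left)
    then show "r *\<^sub>R v \<in> V" unfolding V_def using subspace_scale[OF L(1) R] by (rule image_eqI)
  qed
  then have "subspace (closure V)" by (rule subspace_closure)
  then obtain p where p: "p \<in> closure V" and orth: "\<And>v. v \<in> closure V \<Longrightarrow> inner (x - p) v = 0"
    using orthogonal_decomposition[of "closure V" x] closed_closure by blast
  have inv: "ell2_map S v \<in> closure V" if S: "S \<in> M" and v: "v \<in> closure V" for S v
  proof -
    have "ell2_map S (ell2_map R x) = ell2_map (S o\<^sub>L R) x" for R by (rule ell2_eqI) simp
    then have "ell2_map S ` V \<subseteq> V" using S L(2) by (auto simp: V_def)
    then have "ell2_map S ` closure V \<subseteq> closure V"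
      using closure_bounded_linear_image_subset[OF bounded_linear_ell2_map, of S V] closure_mono
      by (meson order_trans)
    then show ?thesis using v by blast
  qed
  have kill: "ell2_map c (x - p) = 0" if c: "c \<in> C" for c
  proof -
    have cM: "c \<in> M" using c C by blast
    then obtain c' where c': "c' \<in> M" "is_adjoint c c'" using star by blast
    have "ell2_map c x \<in> closure V"
      using c C(1) closure_subset[of V] by (auto simp: V_def)
    then have "ell2_map c (x - p) \<in> closure V"
      using subspace_diff[OF \<open>subspace (closure V)\<close> _ inv[OF cM p]] linear_diff[OF bounded_linear.linear[OF bounded_linear_ell2_map]]
      by metis
    then have "ell2_map c' (ell2_map c (x - p)) \<in> closure V" by (rule inv[OF c'(1)])
    then have "inner (x - p) (ell2_map c' (ell2_map c (x - p))) = 0" by (rule orth)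
    moreover have "inner (ell2_map c (x - p)) (ell2_map c (x - p))
        = inner (x - p) (ell2_map c' (ell2_map c (x - p)))"
      unfolding inner_ell2_def ell2_map.rep_eq is_adjoint_inner[OF c'(2)] ..
    ultimately show ?thesis by simp
  qed
  have "ell2_map T (x - p) = 0"
  proof (rule ell2_eqI)
    fix n
    have "\<forall>c\<in>C. c (ell2_nth (x - p) n) = 0"
      using kill by (metis ell2_map.rep_eq ell2_nth_simps(1))
    then show "ell2_nth (ell2_map T (x - p)) n = ell2_nth 0 n" using T(2) by simp
  qed
  then have "ell2_map T x = ell2_map T p"
    using linear_diff[OF bounded_linear.linear[OF bounded_linear_ell2_map[of T]], of x p] by simp
  then have "ell2_map T x \<in> closure V" using inv[OF T(1) p] by simp
  then obtain v where "v \<in> V" "dist v (ell2_map T x) < sqrt \<epsilon>"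
    using \<open>\<epsilon> > 0\<close> closure_approachable by (metis real_sqrt_gt_0_iff)
  then obtain S where S: "S \<in> L" "norm (ell2_map S x - ell2_map T x) < sqrt \<epsilon>"
    by (auto simp: V_def dist_norm)
  have "(\<Sum>n. (norm (blinfun_apply (S - T) (\<xi> n)))\<^sup>2) = (norm (ell2_map S x - ell2_map T x))\<^sup>2"
    by (simp add: norm_ell2_square nth blinfun.diff_left)
  also have "\<dots> < (sqrt \<epsilon>)\<^sup>2" using S(2) by (intro power_strict_mono) auto
  also have "\<dots> = \<epsilon>" using \<open>\<epsilon> > 0\<close> by simp
  finally show ?thesis using S(1) by blast
qed

section \<open>The weak* topology\<close>

lemma vector_functional_normal: "(\<lambda>T. cinner (blinfun_apply T h) k) \<in> normal_functionals"
proof -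
  define x where "x n = (if n = 0 then h else 0)" for n :: nat
  define y where "y n = (if n = 0 then k else 0)" for n :: nat
  have "(\<lambda>n. cinner (blinfun_apply T (x n)) (y n)) = (\<lambda>n. if n = 0 then cinner (T h) k else 0)" for T
    by (auto simp: x_def y_def)
  then have "(\<lambda>n. cinner (blinfun_apply T (x n)) (y n)) sums cinner (T h) k" for T
    using sums_single[of 0 "\<lambda>_. cinner (T h) k"] by simp
  then have "(\<lambda>T. cinner (blinfun_apply T h) k) = (\<lambda>T. \<Sum>n. cinner (blinfun_apply T (x n)) (y n))"
    by (simp add: sums_iff)
  moreover have "summable (\<lambda>n. (norm (x n))\<^sup>2)" "summable (\<lambda>n. (norm (y n))\<^sup>2)"
    by (rule summable_finite[of "{0}"]; simp add: x_def y_def)+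
  ultimately show ?thesis unfolding normal_functionals_def by blast
qed

lemma topspace_weakstar: "topspace weakstar_topology = (B_ops :: ('h::complex_hilbert \<Rightarrow>\<^sub>L 'h) set)"
proof -
  have "{T \<in> B_ops. (\<lambda>T. cinner (blinfun_apply T (0::'h)) (0::'h)) T \<in> UNIV} \<in>
      {{T \<in> B_ops. \<phi> T \<in> U} | \<phi> U. \<phi> \<in> normal_functionals \<and> open U}"
    using vector_functional_normal by blast
  then show ?thesis by (auto simp: weakstar_topology_def)
qed

lemma weakstar_open_neighbourhood:
  assumes "openin weakstar_topology W" and "T \<in> W"
  shows "\<exists>F \<epsilon>. finite F \<and> F \<subseteq> normal_functionals \<and> \<epsilon> > 0 \<and>
    (\<forall>S\<in>B_ops. (\<forall>\<phi>\<in>F. cmod (\<phi> S - \<phi> T) < \<epsilon>) \<longrightarrow> S \<in> W)"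
proof -
  have "generate_topology_on {{T \<in> B_ops. \<phi> T \<in> U} | \<phi> U. \<phi> \<in> normal_functionals \<and> open U} W"
    using assms(1) by (simp add: weakstar_topology_def openin_topology_generated_by_iff)
  then show ?thesis using assms(2)
  proof (induction rule: generate_topology_on.induct)
    case (Int a b)
    from Int.IH(1) Int.prems obtain F \<epsilon> where
      F: "finite F" "F \<subseteq> normal_functionals" "\<epsilon> > 0"
        "\<forall>S\<in>B_ops. (\<forall>\<phi>\<in>F. cmod (\<phi> S - \<phi> T) < \<epsilon>) \<longrightarrow> S \<in> a" by auto
    from Int.IH(2) Int.prems obtain F' \<epsilon>' where
      F': "finite F'" "F' \<subseteq> normal_functionals" "\<epsilon>' > 0"
        "\<forall>S\<in>B_ops. (\<forall>\<phi>\<in>F'. cmod (\<phi> S - \<phi> T) < \<epsilon>') \<longrightarrow> S \<in> b" by auto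
    show ?case
      by (rule exI[of _ "F \<union> F'"], rule exI[of _ "min \<epsilon> \<epsilon>'"]) (use F F' in auto)
  next
    case (UN K)
    then obtain k where k: "k \<in> K" "T \<in> k" by blast
    from UN.IH[OF k] obtain F \<epsilon> where "finite F" "F \<subseteq> normal_functionals" "\<epsilon> > 0"
      "\<forall>S\<in>B_ops. (\<forall>\<phi>\<in>F. cmod (\<phi> S - \<phi> T) < \<epsilon>) \<longrightarrow> S \<in> k" by auto
    with k(1) show ?case by (intro exI[of _ F] exI[of _ \<epsilon>]) blast
  next
    case (Basis s)
    then obtain \<phi> U where \<phi>: "s = {T \<in> B_ops. \<phi> T \<in> U}" "\<phi> \<in> normal_functionals" "open U" by blast
    then obtain \<epsilon> where "\<epsilon> > 0" "\<forall>z. dist z (\<phi> T) < \<epsilon> \<longrightarrow> z \<in> U"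
      using Basis.prems open_dist by (metis (no_types, lifting) mem_Collect_eq)
    then show ?case
      using \<phi> by (intro exI[of _ "{\<phi>}"] exI[of _ \<epsilon>]) (auto simp: dist_norm)
  qed simp
qed

lemma weakstar_closed_approximation:
  assumes "closedin weakstar_topology J" and "T \<in> B_ops"
    and approx: "\<And>F \<epsilon>. finite F \<Longrightarrow> F \<subseteq> normal_functionals \<Longrightarrow> \<epsilon> > 0 \<Longrightarrow>
      \<exists>S\<in>J. \<forall>\<phi>\<in>F. cmod (\<phi> S - \<phi> T) < \<epsilon>"
  shows "T \<in> J"
proof (rule ccontr)
  assume "T \<notin> J"
  then have "T \<in> topspace weakstar_topology - J" using assms(2) by (simp add: topspace_weakstar)
  moreover have "openin weakstar_topology (topspace weakstar_topology - J)"
    using assms(1) by blast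
  ultimately obtain F \<epsilon> where F: "finite F" "F \<subseteq> normal_functionals" "\<epsilon> > 0"
    and *: "\<forall>S\<in>B_ops. (\<forall>\<phi>\<in>F. cmod (\<phi> S - \<phi> T) < \<epsilon>) \<longrightarrow> S \<in> topspace weakstar_topology - J"
    using weakstar_open_neighbourhood[of "topspace weakstar_topology - J" T] by metis
  obtain S where "S \<in> J" "\<forall>\<phi>\<in>F. cmod (\<phi> S - \<phi> T) < \<epsilon>" using approx[OF F] by blast
  moreover from this have "S \<in> B_ops"
    using closedin_subset[OF assms(1)] by (auto simp: topspace_weakstar)
  ultimately show False using * by blast
qed

text \<open>A weak* neighbourhood involves finitely many normal functionals. Interleaving their sequences makes
them subsequences of a single one, so that approximation along one sequence suffices.\<close>

lemma common_refinement:
  fixes F :: "(nat \<Rightarrow> 'a::real_normed_vector) set"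
  assumes "finite F" and "\<And>x. x \<in> F \<Longrightarrow> summable (\<lambda>n. (norm (x n))\<^sup>2)"
  shows "\<exists>z. summable (\<lambda>n. (norm (z n))\<^sup>2) \<and> (\<forall>x\<in>F. \<exists>g. inj g \<and> x = z \<circ> g)"
  using assms
proof (induction F)
  case empty
  show ?case by (rule exI[of _ "\<lambda>_. 0"]) simp
next
  case (insert x F)
  have "\<exists>z. summable (\<lambda>n. (norm (z n))\<^sup>2) \<and> (\<forall>x\<in>F. \<exists>g. inj g \<and> x = z \<circ> g)"
    by (rule insert.IH) (rule insert.prems, simp)
  then obtain z where z: "summable (\<lambda>n. (norm (z n))\<^sup>2)"
    and F: "\<forall>x\<in>F. \<exists>g. inj g \<and> x = z \<circ> g" by (elim exE conjE)
  \<comment> \<open>\<open>x\<close> occupies the even places and \<open>z\<close> the odd ones.\<close>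
  define w where "w n = (if even n then x (n div 2) else z ((n - 1) div 2))" for n :: nat
  have "(\<lambda>n. (norm (w n))\<^sup>2)
      = (\<lambda>n. if even n then (norm (x (n div 2)))\<^sup>2 else (norm (z ((n - 1) div 2)))\<^sup>2)"
    by (auto simp: w_def)
  moreover have "summable \<dots>"
    by (rule sums_summable, rule sums_if[OF summable_sums[OF z] summable_sums])
      (rule insert.prems, simp)
  ultimately have sw: "summable (\<lambda>n. (norm (w n))\<^sup>2)" by simp
  have xw: "\<exists>g. inj g \<and> x = w \<circ> g"
    by (rule exI[of _ "\<lambda>n. 2 * n"]) (auto simp: inj_def w_def)
  have "\<exists>g. inj g \<and> y = w \<circ> g" if "y \<in> F" for y
  proof -
    obtain g where "inj g" "y = z \<circ> g" using F \<open>y \<in> F\<close> by blast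
    then show ?thesis by (intro exI[of _ "\<lambda>n. 2 * g n + 1"]) (auto simp: inj_def w_def)
  qed
  with sw xw show ?case by (intro exI[of _ w] conjI) (assumption, intro ballI, elim insertE, fast+)
qed

text \<open>The Cauchy--Schwarz inequality in the form of an arithmetic-geometric mean inequality with a free
parameter, which is linear in both series.\<close>

lemma cmod_suminf_cinner_le:
  fixes a b :: "nat \<Rightarrow> 'h::complex_hilbert"
  assumes a: "summable (\<lambda>n. (norm (a n))\<^sup>2)" and b: "summable (\<lambda>n. (norm (b n))\<^sup>2)" and t: "t > 0"
  shows "summable (\<lambda>n. cinner (a n) (b n))"
    and "2 * cmod (\<Sum>n. cinner (a n) (b n)) \<le> t * (\<Sum>n. (norm (a n))\<^sup>2) + (\<Sum>n. (norm (b n))\<^sup>2) / t"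
proof -
  let ?m = "\<lambda>n. (t * (norm (a n))\<^sup>2 + (norm (b n))\<^sup>2 / t) / 2"
  have m: "summable ?m" using a b by (intro summable_divide summable_add summable_mult)
  have le: "norm (cinner (a n) (b n)) \<le> ?m n" for n
  proof -
    have "2 * (sqrt t * norm (a n)) * (norm (b n) / sqrt t)
        \<le> (sqrt t * norm (a n))\<^sup>2 + (norm (b n) / sqrt t)\<^sup>2"
      by (rule sum_squares_bound)
    then have "2 * (norm (a n) * norm (b n)) \<le> t * (norm (a n))\<^sup>2 + (norm (b n))\<^sup>2 / t"
      using t by (simp add: power_mult_distrib power_divide mult.assoc)
    then show ?thesis using cmod_cinner_le[of "a n" "b n"] by simp
  qed
  show "summable (\<lambda>n. cinner (a n) (b n))"
    by (rule summable_comparison_test'[OF m]) (rule le)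
  have "cmod (\<Sum>n. cinner (a n) (b n)) \<le> (\<Sum>n. ?m n)"
    by (rule norm_suminf_le[OF le m])
  also have "\<dots> = (t * (\<Sum>n. (norm (a n))\<^sup>2) + (\<Sum>n. (norm (b n))\<^sup>2) / t) / 2"
    using a b by (simp add: suminf_divide suminf_add[symmetric] suminf_mult summable_divide summable_mult summable_add)
  finally show "2 * cmod (\<Sum>n. cinner (a n) (b n)) \<le> t * (\<Sum>n. (norm (a n))\<^sup>2) + (\<Sum>n. (norm (b n))\<^sup>2) / t"
    by simp
qed

text \<open>The parameter \<open>E\<close> covers two cases: \<open>R = S - T\<close>, tested on the first sequence of a normal functional,
and \<open>R\<close> the adjoint of \<open>S - T\<close>, tested on the second. These are suited to left and to right ideals.\<close>

lemma weakstar_closed_if_families_approximated: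
  fixes J :: "('h::complex_hilbert \<Rightarrow>\<^sub>L 'h) set"
    and E :: "('h \<Rightarrow>\<^sub>L 'h) \<Rightarrow> ('h \<Rightarrow>\<^sub>L 'h) \<Rightarrow> bool"
  assumes J: "closedin weakstar_topology J" and T: "T \<in> B_ops"
    and bound: "\<And>\<phi>. \<phi> \<in> normal_functionals \<Longrightarrow> \<exists>\<xi> B. summable (\<lambda>n. (norm (\<xi> n))\<^sup>2) \<and> 0 \<le> B \<and>
      (\<forall>S\<in>J. \<forall>R t. E S R \<longrightarrow> t > 0 \<longrightarrow>
        2 * cmod (\<phi> S - \<phi> T) \<le> t * (\<Sum>n. (norm (blinfun_apply R (\<xi> n)))\<^sup>2) + B / t)"
    and approx: "\<And>\<xi> \<epsilon>. summable (\<lambda>n. (norm (\<xi> n))\<^sup>2) \<Longrightarrow> \<epsilon> > 0 \<Longrightarrow>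
      \<exists>S\<in>J. \<exists>R. E S R \<and> (\<Sum>n. (norm (blinfun_apply R (\<xi> n)))\<^sup>2) < \<epsilon>"
  shows "T \<in> J"
proof (rule weakstar_closed_approximation[OF J T])
  fix F :: "(('h \<Rightarrow>\<^sub>L 'h) \<Rightarrow> complex) set" and \<epsilon> :: real
  assume F: "finite F" "F \<subseteq> normal_functionals" and \<epsilon>: "\<epsilon> > 0"
  have "\<forall>\<phi>\<in>F. \<exists>\<xi> B. summable (\<lambda>n. (norm (\<xi> n))\<^sup>2) \<and> 0 \<le> B \<and>
      (\<forall>S\<in>J. \<forall>R t. E S R \<longrightarrow> t > 0 \<longrightarrow>
        2 * cmod (\<phi> S - \<phi> T) \<le> t * (\<Sum>n. (norm (blinfun_apply R (\<xi> n)))\<^sup>2) + B / t)"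
    using F(2) bound by blast
  from bchoice[OF this] obtain X where "\<forall>\<phi>\<in>F. \<exists>B. summable (\<lambda>n. (norm (X \<phi> n))\<^sup>2) \<and> 0 \<le> B \<and>
      (\<forall>S\<in>J. \<forall>R t. E S R \<longrightarrow> t > 0 \<longrightarrow>
        2 * cmod (\<phi> S - \<phi> T) \<le> t * (\<Sum>n. (norm (blinfun_apply R (X \<phi> n)))\<^sup>2) + B / t)" ..
  from bchoice[OF this] obtain b where XB: "\<forall>\<phi>\<in>F. summable (\<lambda>n. (norm (X \<phi> n))\<^sup>2) \<and> 0 \<le> b \<phi> \<and>
      (\<forall>S\<in>J. \<forall>R t. E S R \<longrightarrow> t > 0 \<longrightarrow>
        2 * cmod (\<phi> S - \<phi> T) \<le> t * (\<Sum>n. (norm (blinfun_apply R (X \<phi> n)))\<^sup>2) + b \<phi> / t)" ..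
  have "\<exists>z. summable (\<lambda>n. (norm (z n))\<^sup>2) \<and> (\<forall>x\<in>X ` F. \<exists>g. inj g \<and> x = z \<circ> g)"
    using F(1) XB by (intro common_refinement) auto
  then obtain z where z: "summable (\<lambda>n. (norm (z n))\<^sup>2)"
    and sub: "\<forall>x\<in>X ` F. \<exists>g. inj g \<and> x = z \<circ> g" by (elim exE conjE)
  define B where "B = sum b F"
  have B: "b \<phi> \<le> B" if "\<phi> \<in> F" for \<phi>
    unfolding B_def using F(1) XB that by (intro member_le_sum) auto
  have B0: "B \<ge> 0" unfolding B_def using XB by (intro sum_nonneg) auto
  \<comment> \<open>Large enough for \<open>B / t < \<epsilon>\<close>.\<close>
  define t where "t = (B + 1) / \<epsilon>"
  have t: "t > 0" using B0 \<epsilon> by (simp add: t_def)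
  obtain S R where S: "S \<in> J" "E S R" and small: "(\<Sum>n. (norm (blinfun_apply R (z n)))\<^sup>2) < \<epsilon> / t"
    using approx[OF z, of "\<epsilon> / t"] t \<epsilon> by auto
  show "\<exists>S\<in>J. \<forall>\<phi>\<in>F. cmod (\<phi> S - \<phi> T) < \<epsilon>"
  proof (intro bexI[of _ S] ballI)
    fix \<phi> assume \<phi>: "\<phi> \<in> F"
    then obtain g where g: "inj g" "X \<phi> = z \<circ> g" using sub by blast
    have "(\<Sum>n. (norm (blinfun_apply R (X \<phi> n)))\<^sup>2)
        = suminf ((\<lambda>n. (norm (blinfun_apply R (z n)))\<^sup>2) \<circ> g)"
      by (simp add: g(2) o_def)
    also have "\<dots> \<le> (\<Sum>n. (norm (blinfun_apply R (z n)))\<^sup>2)"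
      by (rule suminf_reindex_mono[OF summable_blinfun_apply[OF z] g(1)]) simp
    finally have "(\<Sum>n. (norm (blinfun_apply R (X \<phi> n)))\<^sup>2) < \<epsilon> / t" using small by simp
    then have "t * (\<Sum>n. (norm (blinfun_apply R (X \<phi> n)))\<^sup>2) < \<epsilon>"
      using t by (simp add: field_simps)
    moreover have "b \<phi> / t < \<epsilon>"
    proof -
      have "b \<phi> * \<epsilon> < (B + 1) * \<epsilon>" using B[OF \<phi>] \<epsilon> by (intro mult_strict_right_mono) auto
      then show ?thesis using B0 by (simp add: t_def divide_less_eq mult.commute)
    qed
    moreover have "2 * cmod (\<phi> S - \<phi> T) \<le> t * (\<Sum>n. (norm (blinfun_apply R (X \<phi> n)))\<^sup>2) + b \<phi> / t"
      using XB \<phi> S t by blast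
    ultimately show "cmod (\<phi> S - \<phi> T) < \<epsilon>" by linarith
  qed (rule S(1))
qed

lemma normal_functional_diff:
  assumes "\<phi> \<in> normal_functionals"
  shows "\<exists>x y. summable (\<lambda>n. (norm (x n))\<^sup>2) \<and> summable (\<lambda>n. (norm (y n))\<^sup>2) \<and>
    (\<forall>S T. \<phi> S - \<phi> T = (\<Sum>n. cinner (blinfun_apply (S - T) (x n)) (y n)))"
proof -
  obtain x y where x: "summable (\<lambda>n. (norm (x n))\<^sup>2)" and y: "summable (\<lambda>n. (norm (y n))\<^sup>2)"
    and \<phi>: "\<phi> = (\<lambda>T. \<Sum>n. cinner (blinfun_apply T (x n)) (y n))"
    using assms unfolding normal_functionals_def by blast
  have "summable (\<lambda>n. cinner (blinfun_apply S (x n)) (y n))" for S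
    by (rule cmod_suminf_cinner_le(1)[OF summable_blinfun_apply[OF x] y zero_less_one])
  then have "\<phi> S - \<phi> T = (\<Sum>n. cinner (blinfun_apply (S - T) (x n)) (y n))" for S T
    unfolding \<phi> by (simp add: suminf_diff blinfun.diff_left cinner_diff_left)
  then show ?thesis using x y by blast
qed

lemma weakstar_closed_if_approximated:
  fixes J :: "('h::complex_hilbert \<Rightarrow>\<^sub>L 'h) set"
  assumes J: "closedin weakstar_topology J" and T: "T \<in> B_ops"
    and approx: "\<And>\<xi> \<epsilon>. summable (\<lambda>n. (norm (\<xi> n))\<^sup>2) \<Longrightarrow> \<epsilon> > 0 \<Longrightarrow>
      \<exists>S\<in>J. (\<Sum>n. (norm (blinfun_apply (S - T) (\<xi> n)))\<^sup>2) < \<epsilon>"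
  shows "T \<in> J"
proof (rule weakstar_closed_if_families_approximated[OF J T, where E = "\<lambda>S R. R = S - T"])
  fix \<phi> :: "('h \<Rightarrow>\<^sub>L 'h) \<Rightarrow> complex" assume "\<phi> \<in> normal_functionals"
  then obtain x y where x: "summable (\<lambda>n. (norm (x n))\<^sup>2)" and y: "summable (\<lambda>n. (norm (y n))\<^sup>2)"
    and diff: "\<And>S T. \<phi> S - \<phi> T = (\<Sum>n. cinner (blinfun_apply (S - T) (x n)) (y n))"
    using normal_functional_diff[of \<phi>] by auto
  have "2 * cmod (\<phi> S - \<phi> T)
      \<le> t * (\<Sum>n. (norm (blinfun_apply (S - T) (x n)))\<^sup>2) + (\<Sum>n. (norm (y n))\<^sup>2) / t"
    if "t > 0" for S t
    unfolding diff by (rule cmod_suminf_cinner_le(2)[OF summable_blinfun_apply[OF x] y that])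
  moreover have "0 \<le> (\<Sum>n. (norm (y n))\<^sup>2)" using y by (intro suminf_nonneg) auto
  ultimately show "\<exists>\<xi> B. summable (\<lambda>n. (norm (\<xi> n))\<^sup>2) \<and> 0 \<le> B \<and>
      (\<forall>S\<in>J. \<forall>R t. R = S - T \<longrightarrow> t > 0 \<longrightarrow>
        2 * cmod (\<phi> S - \<phi> T) \<le> t * (\<Sum>n. (norm (blinfun_apply R (\<xi> n)))\<^sup>2) + B / t)"
    using x by blast
next
  fix \<xi> :: "nat \<Rightarrow> 'h" and \<epsilon> :: real
  assume "summable (\<lambda>n. (norm (\<xi> n))\<^sup>2)" "\<epsilon> > 0"
  then show "\<exists>S\<in>J. \<exists>R. R = S - T \<and> (\<Sum>n. (norm (blinfun_apply R (\<xi> n)))\<^sup>2) < \<epsilon>"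
    using approx by blast
qed

lemma weakstar_closed_if_adjoints_approximated:
  fixes J :: "('h::complex_hilbert \<Rightarrow>\<^sub>L 'h) set"
  assumes J: "closedin weakstar_topology J" and T: "T \<in> B_ops"
    and approx: "\<And>\<xi> \<epsilon>. summable (\<lambda>n. (norm (\<xi> n))\<^sup>2) \<Longrightarrow> \<epsilon> > 0 \<Longrightarrow>
      \<exists>S\<in>J. \<exists>R. is_adjoint (S - T) R \<and> (\<Sum>n. (norm (blinfun_apply R (\<xi> n)))\<^sup>2) < \<epsilon>"
  shows "T \<in> J"
proof (rule weakstar_closed_if_families_approximated[OF J T, where E = "\<lambda>S R. is_adjoint (S - T) R"])
  fix \<phi> :: "('h \<Rightarrow>\<^sub>L 'h) \<Rightarrow> complex" assume "\<phi> \<in> normal_functionals"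
  then obtain x y where x: "summable (\<lambda>n. (norm (x n))\<^sup>2)" and y: "summable (\<lambda>n. (norm (y n))\<^sup>2)"
    and diff: "\<And>S T. \<phi> S - \<phi> T = (\<Sum>n. cinner (blinfun_apply (S - T) (x n)) (y n))"
    using normal_functional_diff[of \<phi>] by auto
  have "2 * cmod (\<phi> S - \<phi> T)
      \<le> t * (\<Sum>n. (norm (blinfun_apply R (y n)))\<^sup>2) + (\<Sum>n. (norm (x n))\<^sup>2) / t"
    if "t > 0" "is_adjoint (S - T) R" for S R t
  proof -
    have "\<phi> S - \<phi> T = (\<Sum>n. cinner (x n) (R (y n)))"
      unfolding diff using that(2) by (simp add: is_adjoint_def)
    then show ?thesis
      using cmod_suminf_cinner_le(2)[OF x summable_blinfun_apply[OF y, of R], of "1 / t"] that(1)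
      by (simp add: algebra_simps)
  qed
  moreover have "0 \<le> (\<Sum>n. (norm (x n))\<^sup>2)" using x by (intro suminf_nonneg) auto
  ultimately show "\<exists>\<xi> B. summable (\<lambda>n. (norm (\<xi> n))\<^sup>2) \<and> 0 \<le> B \<and>
      (\<forall>S\<in>J. \<forall>R t. is_adjoint (S - T) R \<longrightarrow> t > 0 \<longrightarrow>
        2 * cmod (\<phi> S - \<phi> T) \<le> t * (\<Sum>n. (norm (blinfun_apply R (\<xi> n)))\<^sup>2) + B / t)"
    using y by blast
qed (rule approx)

section \<open>Weak* closed one-sided ideals\<close>

lemma closedin_weakstar_vanishing:
  assumes M: "closedin weakstar_topology M"
  shows "closedin weakstar_topology {T \<in> M. \<forall>h k. Z h k \<longrightarrow> cinner (blinfun_apply T h) k = 0}"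
proof -
  define U where "U h k = {T \<in> B_ops. cinner (blinfun_apply T h) k \<in> - {0}}" for h k :: 'a
  have "openin weakstar_topology (U h k)" for h k
    unfolding weakstar_topology_def
  proof (rule topology_generated_by_Basis, rule CollectI, intro exI conjI)
    show "U h k = {T \<in> B_ops. cinner (blinfun_apply T h) k \<in> - {0}}" by (rule U_def)
    show "(\<lambda>T. cinner (blinfun_apply T h) k) \<in> normal_functionals" by (rule vector_functional_normal)
  qed (intro open_Compl closed_singleton)
  then have "openin weakstar_topology (\<Union>{U h k | h k. Z h k})" by (intro openin_Union) auto
  then have "closedin weakstar_topology (M - \<Union>{U h k | h k. Z h k})"
    by (rule closedin_diff[OF M])
  moreover have "M - \<Union>{U h k | h k. Z h k}
      = {T \<in> M. \<forall>h k. Z h k \<longrightarrow> cinner (blinfun_apply T h) k = 0}"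
    using closedin_subset[OF M] by (auto simp: U_def topspace_weakstar)
  ultimately show ?thesis by simp
qed

locale von_neumann =
  fixes M :: "('h::complex_hilbert \<Rightarrow>\<^sub>L 'h) set"
  assumes M: "von_neumann_algebra M"
begin

lemma M_B_ops: "T \<in> M \<Longrightarrow> T \<in> B_ops"
  and M_subspace: "op_vs.subspace M"
  and M_compose: "S \<in> M \<Longrightarrow> T \<in> M \<Longrightarrow> S o\<^sub>L T \<in> M"
  and M_closed: "closedin weakstar_topology M"
  using M by (auto simp: von_neumann_algebra_def op_subalgebra_def op_prod_def)

lemma M_adjoint: "T \<in> M \<Longrightarrow> \<exists>S\<in>M. is_adjoint T S"
proof -
  assume "T \<in> M"
  then have "T \<in> op_star M" using M by (simp add: von_neumann_algebra_def)
  then show ?thesis unfolding op_star_def using is_adjoint_sym by blast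
qed

lemma op_star_subset: "S \<subseteq> M \<Longrightarrow> op_star S \<subseteq> M"
  using M unfolding von_neumann_algebra_def op_star_def by blast

lemma op_star_eq: "S \<subseteq> M \<Longrightarrow> op_star S = {t \<in> M. \<exists>s\<in>S. is_adjoint s t}"
  using op_star_subset M_B_ops unfolding op_star_def by blast

lemma subspace_vanishing:
  "op_vs.subspace {T \<in> M. \<forall>h k. Z h k \<longrightarrow> cinner (blinfun_apply T h) k = 0}"
  using op_vs.subspace_0[OF M_subspace] op_vs.subspace_add[OF M_subspace]
    op_vs.subspace_scale[OF M_subspace]
  by (auto simp: op_vs.subspace_def blinfun.add_left cinner_add_left op_scale.rep_eq cinner_scaleC_left)

text \<open>The operators in \<open>M\<close> that vanish on the common kernel of \<open>C\<close> form a weak* closed left ideal. That it is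
the smallest one containing \<open>C\<close> is the approximation property of left ideals.\<close>

lemma weakstar_left_ideal_generated_eq:
  assumes C: "C \<subseteq> M"
  shows "weakstar_left_ideal_generated M C = {T \<in> M. \<forall>k. (\<forall>c\<in>C. c k = 0) \<longrightarrow> T k = 0}"
proof
  let ?J = "{T \<in> M. \<forall>k. (\<forall>c\<in>C. c k = 0) \<longrightarrow> T k = 0}"
  have eq: "?J = {T \<in> M. \<forall>k g. (\<forall>c\<in>C. c k = 0) \<longrightarrow> cinner (T k) g = 0}"
    using eq_0_if_orthogonal by auto
  have "op_vs.subspace ?J" "closedin weakstar_topology ?J"
    unfolding eq by (rule subspace_vanishing closedin_weakstar_vanishing[OF M_closed])+
  moreover have "op_prod M ?J \<subseteq> ?J" by (auto simp: op_prod_def M_compose)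
  ultimately show "weakstar_left_ideal_generated M C \<subseteq> ?J"
    unfolding weakstar_left_ideal_generated_def using C by (intro hull_minimal) auto
  show "?J \<subseteq> weakstar_left_ideal_generated M C"
  proof
    fix T assume T: "T \<in> ?J"
    have "T \<in> J" if "C \<subseteq> J" and "J \<subseteq> M" and sub: "op_vs.subspace J"
      and ideal: "op_prod M J \<subseteq> J" and closed: "closedin weakstar_topology J" for J
    proof (rule weakstar_closed_if_approximated[OF closed])
      show "T \<in> B_ops" using T M_B_ops by blast
      fix \<xi> :: "nat \<Rightarrow> 'h" and \<epsilon> :: real
      assume "summable (\<lambda>n. (norm (\<xi> n))\<^sup>2)" "\<epsilon> > 0"
      then show "\<exists>S\<in>J. (\<Sum>n. (norm (blinfun_apply (S - T) (\<xi> n)))\<^sup>2) < \<epsilon>"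
      proof (rule approximation_by_left_ideal[OF _ _ M_adjoint that(1) C, rotated -2])
        show "subspace J" using sub by (rule subspace_op_vs_imp_subspace)
        show "R \<in> M \<Longrightarrow> S \<in> J \<Longrightarrow> R o\<^sub>L S \<in> J" for R S using ideal by (auto simp: op_prod_def)
      qed (use T in auto)
    qed
    then show "T \<in> weakstar_left_ideal_generated M C"
      by (auto simp: weakstar_left_ideal_generated_def hull_def)
  qed
qed

text \<open>The adjoints of the elements of a right ideal \<open>J\<close> form a left ideal. Approximating the adjoint of \<open>T\<close>
within it, along the second sequences of normal functionals, gives weak* approximations of \<open>T\<close> in \<open>J\<close>.\<close>

lemma weakstar_right_ideal_generated_eq:
  assumes C: "C \<subseteq> M"
  shows "weakstar_right_ideal_generated M C =
    {T \<in> M. \<forall>k. (\<forall>c\<in>C. \<forall>g. cinner (c g) k = 0) \<longrightarrow> (\<forall>g. cinner (T g) k = 0)}"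
proof
  let ?J = "{T \<in> M. \<forall>k. (\<forall>c\<in>C. \<forall>g. cinner (c g) k = 0) \<longrightarrow> (\<forall>g. cinner (T g) k = 0)}"
  have eq: "?J = {T \<in> M. \<forall>g k. (\<forall>c\<in>C. \<forall>g. cinner (c g) k = 0) \<longrightarrow> cinner (T g) k = 0}"
    by auto
  have "op_vs.subspace ?J" "closedin weakstar_topology ?J"
    unfolding eq by (rule subspace_vanishing closedin_weakstar_vanishing[OF M_closed])+
  moreover have "op_prod ?J M \<subseteq> ?J" by (auto simp: op_prod_def M_compose)
  ultimately show "weakstar_right_ideal_generated M C \<subseteq> ?J"
    unfolding weakstar_right_ideal_generated_def using C by (intro hull_minimal) auto
  show "?J \<subseteq> weakstar_right_ideal_generated M C"
  proof
    fix T assume T: "T \<in> ?J"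
    then obtain T' where T': "T' \<in> M" "is_adjoint T T'" using M_adjoint by blast
    have "T \<in> J" if CJ: "C \<subseteq> J" and JM: "J \<subseteq> M" and sub: "op_vs.subspace J"
      and ideal: "op_prod J M \<subseteq> J" and closed: "closedin weakstar_topology J" for J
    proof (rule weakstar_closed_if_adjoints_approximated[OF closed])
      show "T \<in> B_ops" using T M_B_ops by blast
      fix \<xi> :: "nat \<Rightarrow> 'h" and \<epsilon> :: real
      assume \<xi>: "summable (\<lambda>n. (norm (\<xi> n))\<^sup>2)" "\<epsilon> > 0"
      have J: "subspace J" and Ms: "subspace M"
        using sub M_subspace by (auto intro: subspace_op_vs_imp_subspace)
      have "\<exists>S\<in>{S' \<in> M. \<exists>S\<in>J. is_adjoint S S'}. (\<Sum>n. (norm (blinfun_apply (S - T') (\<xi> n)))\<^sup>2) < \<epsilon>"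
      proof (rule approximation_by_left_ideal[where M = M and C = "{c' \<in> M. \<exists>c\<in>C. is_adjoint c c'}"])
        show "subspace {S' \<in> M. \<exists>S\<in>J. is_adjoint S S'}"
          unfolding subspace_def
        proof (intro conjI ballI allI)
          show "0 \<in> {S' \<in> M. \<exists>S\<in>J. is_adjoint S S'}"
            using subspace_0[OF J] subspace_0[OF Ms] by (auto simp: is_adjoint_def intro!: bexI[of _ 0])
        next
          fix R' S' assume "R' \<in> {S' \<in> M. \<exists>S\<in>J. is_adjoint S S'}" "S' \<in> {S' \<in> M. \<exists>S\<in>J. is_adjoint S S'}"
          then obtain R S where "R \<in> J" "S \<in> J" "R' \<in> M" "S' \<in> M" "is_adjoint R R'" "is_adjoint S S'"
            by blast
          then show "R' + S' \<in> {S' \<in> M. \<exists>S\<in>J. is_adjoint S S'}"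
            using subspace_add[OF J] subspace_add[OF Ms]
            by (auto simp: is_adjoint_def blinfun.add_left cinner_add_left cinner_add_right
                intro!: bexI[of _ "R + S"])
        next
          fix r S' assume "S' \<in> {S' \<in> M. \<exists>S\<in>J. is_adjoint S S'}"
          then obtain S where "S \<in> J" "S' \<in> M" "is_adjoint S S'" by blast
          then show "r *\<^sub>R S' \<in> {S' \<in> M. \<exists>S\<in>J. is_adjoint S S'}"
            using subspace_scale[OF J] subspace_scale[OF Ms]
            by (auto simp: is_adjoint_def blinfun.scaleR_left scaleR_scaleC cinner_scaleC_left
                cinner_scaleC_right intro!: bexI[of _ "r *\<^sub>R S"])
        qed
      next
        fix R S' assume R: "R \<in> M" and "S' \<in> {S' \<in> M. \<exists>S\<in>J. is_adjoint S S'}"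
        then obtain S where S: "S \<in> J" "S' \<in> M" "is_adjoint S S'" by blast
        obtain R' where R': "R' \<in> M" "is_adjoint R R'" using M_adjoint R by blast
        have "S o\<^sub>L R' \<in> J" using ideal S R' by (auto simp: op_prod_def)
        moreover have "is_adjoint (S o\<^sub>L R') (R o\<^sub>L S')"
          by (rule is_adjoint_compose[OF S(3) is_adjoint_sym[OF R'(2)]])
        ultimately show "R o\<^sub>L S' \<in> {S' \<in> M. \<exists>S\<in>J. is_adjoint S S'}"
          using R S M_compose by blast
      next
        fix k assume k: "\<forall>c\<in>{c' \<in> M. \<exists>c\<in>C. is_adjoint c c'}. c k = 0"
        have "cinner (c g) k = 0" if c: "c \<in> C" for c g
        proof -
          obtain c' where "c' \<in> M" "is_adjoint c c'" using M_adjoint c C by blast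
          then show ?thesis using k c by (simp add: is_adjoint_def) (metis cinner_zero_right)
        qed
        then have "cinner (T g) k = 0" for g using T by blast
        then have "cinner g (T' k) = 0" for g using T'(2) by (simp add: is_adjoint_def)
        then show "T' k = 0" using cinner_self_eq_0_iff by blast
      qed (use \<xi> T' CJ M_adjoint in auto)
      then obtain S S' where S: "S \<in> J" "is_adjoint S S'"
        and small: "(\<Sum>n. (norm (blinfun_apply (S' - T') (\<xi> n)))\<^sup>2) < \<epsilon>" by blast
      have "is_adjoint (S - T) (S' - T')"
        using S(2) T'(2) by (simp add: is_adjoint_def blinfun.diff_left cinner_diff_left cinner_diff_right)
      then show "\<exists>S\<in>J. \<exists>R. is_adjoint (S - T) R \<and> (\<Sum>n. (norm (blinfun_apply R (\<xi> n)))\<^sup>2) < \<epsilon>"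
        using S(1) small by blast
    qed
    then show "T \<in> weakstar_right_ideal_generated M C"
      by (auto simp: weakstar_right_ideal_generated_def hull_def)
  qed
qed

section \<open>Support projections and ideals\<close>

text \<open>The condition on the ideal and the condition on support projections both say that the adjoint \<open>s\<close> of
each \<open>y\<close> in \<open>Y\<close> leaves the common kernel of \<open>C\<close> invariant.\<close>

lemma left_condition_iff:
  assumes C: "C \<subseteq> M" and Y: "Y \<subseteq> M"
  shows "op_prod C (op_star Y) \<subseteq> weakstar_left_ideal_generated M C \<longleftrightarrow>
      (\<forall>k. (\<forall>c\<in>C. c k = 0) \<longrightarrow> (\<forall>y\<in>Y. \<forall>s\<in>M. is_adjoint y s \<longrightarrow> (\<forall>c\<in>C. c (s k) = 0)))"
    and "proj_le (left_support (op_prod Y (op_star C))) (right_support C) \<longleftrightarrow>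
      (\<forall>k. (\<forall>c\<in>C. c k = 0) \<longrightarrow> (\<forall>y\<in>Y. \<forall>s\<in>M. is_adjoint y s \<longrightarrow> (\<forall>c\<in>C. c (s k) = 0)))"
proof -
  show "op_prod C (op_star Y) \<subseteq> weakstar_left_ideal_generated M C \<longleftrightarrow>
      (\<forall>k. (\<forall>c\<in>C. c k = 0) \<longrightarrow> (\<forall>y\<in>Y. \<forall>s\<in>M. is_adjoint y s \<longrightarrow> (\<forall>c\<in>C. c (s k) = 0)))"
  proof
    assume L: "op_prod C (op_star Y) \<subseteq> weakstar_left_ideal_generated M C"
    show "\<forall>k. (\<forall>c\<in>C. c k = 0) \<longrightarrow> (\<forall>y\<in>Y. \<forall>s\<in>M. is_adjoint y s \<longrightarrow> (\<forall>c\<in>C. c (s k) = 0))"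
    proof (intro allI impI ballI)
      fix k y s c assume k: "\<forall>c\<in>C. c k = 0" and s: "y \<in> Y" "s \<in> M" "is_adjoint y s" and c: "c \<in> C"
      have "c o\<^sub>L s \<in> op_prod C (op_star Y)"
        unfolding op_prod_def op_star_eq[OF Y] using s c by blast
      then have "(c o\<^sub>L s) k = 0"
        using L k unfolding weakstar_left_ideal_generated_eq[OF C] by blast
      then show "c (s k) = 0" by simp
    qed
  next
    assume R: "\<forall>k. (\<forall>c\<in>C. c k = 0) \<longrightarrow> (\<forall>y\<in>Y. \<forall>s\<in>M. is_adjoint y s \<longrightarrow> (\<forall>c\<in>C. c (s k) = 0))"
    show "op_prod C (op_star Y) \<subseteq> weakstar_left_ideal_generated M C"
    proof
      fix T assume "T \<in> op_prod C (op_star Y)"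
      then obtain s y c where s: "s \<in> M" "y \<in> Y" "is_adjoint y s" "c \<in> C" and T: "T = c o\<^sub>L s"
        unfolding op_prod_def op_star_eq[OF Y] by blast
      have "c o\<^sub>L s \<in> M" using s C M_compose by blast
      then show "T \<in> weakstar_left_ideal_generated M C"
        unfolding weakstar_left_ideal_generated_eq[OF C] T using R s by simp
    qed
  qed
  have CB: "C \<subseteq> B_ops" using C M_B_ops by blast
  have key: "(\<forall>g. cinner (y (t g)) k = 0) \<longleftrightarrow> c (s k) = 0"
    if ys: "is_adjoint y s" and ct: "is_adjoint c t" for y s c t k
  proof -
    have "cinner (y (t g)) k = cinner g (c (s k))" for g
      using ys is_adjoint_sym[OF ct] by (simp add: is_adjoint_def)
    then show ?thesis by (simp add: all_cinner_eq_0_iff)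
  qed
  have "(\<forall>T\<in>op_prod Y (op_star C). \<forall>g. cinner (T g) k = 0)
      \<longleftrightarrow> (\<forall>y\<in>Y. \<forall>s\<in>M. is_adjoint y s \<longrightarrow> (\<forall>c\<in>C. c (s k) = 0))" for k
  proof
    assume L: "\<forall>T\<in>op_prod Y (op_star C). \<forall>g. cinner (T g) k = 0"
    show "\<forall>y\<in>Y. \<forall>s\<in>M. is_adjoint y s \<longrightarrow> (\<forall>c\<in>C. c (s k) = 0)"
    proof (intro ballI impI)
      fix y s c assume y: "y \<in> Y" "is_adjoint y s" and c: "c \<in> C"
      obtain t where t: "t \<in> M" "is_adjoint c t" using M_adjoint c C by blast
      have "y o\<^sub>L t \<in> op_prod Y (op_star C)"
        unfolding op_prod_def op_star_eq[OF C] using t y c by blast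
      then have "\<forall>g. cinner ((y o\<^sub>L t) g) k = 0" using L by blast
      then show "c (s k) = 0" using key[OF y(2) t(2)] by simp
    qed
  next
    assume R: "\<forall>y\<in>Y. \<forall>s\<in>M. is_adjoint y s \<longrightarrow> (\<forall>c\<in>C. c (s k) = 0)"
    show "\<forall>T\<in>op_prod Y (op_star C). \<forall>g. cinner (T g) k = 0"
    proof
      fix T assume "T \<in> op_prod Y (op_star C)"
      then obtain y c t where y: "y \<in> Y" and t: "is_adjoint c t" "c \<in> C" and T: "T = y o\<^sub>L t"
        unfolding op_prod_def op_star_eq[OF C] by blast
      obtain s where s: "s \<in> M" "is_adjoint y s" using M_adjoint y Y by blast
      have "c (s k) = 0" using R y s t by blast
      then show "\<forall>g. cinner (T g) k = 0" using key[OF s(2) t(1)] by (simp add: T)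
    qed
  qed
  then show "proj_le (left_support (op_prod Y (op_star C))) (right_support C) \<longleftrightarrow>
      (\<forall>k. (\<forall>c\<in>C. c k = 0) \<longrightarrow> (\<forall>y\<in>Y. \<forall>s\<in>M. is_adjoint y s \<longrightarrow> (\<forall>c\<in>C. c (s k) = 0)))"
    by (simp add: proj_le_iff_kernel[OF left_support_kernel(1) right_support_kernel(1)[OF CB]]
        left_support_kernel(2) right_support_kernel(2)[OF CB])
qed

text \<open>Here both conditions say that each \<open>y\<close> in \<open>Y\<close> leaves the orthogonal complement of the ranges of the
elements of \<open>C\<close> invariant.\<close>

lemma right_condition_iff:
  assumes C: "C \<subseteq> M" and Y: "Y \<subseteq> M"
  shows "op_prod (op_star Y) C \<subseteq> weakstar_right_ideal_generated M C \<longleftrightarrow>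
      (\<forall>k. (\<forall>c\<in>C. \<forall>g. cinner (c g) k = 0) \<longrightarrow> (\<forall>y\<in>Y. \<forall>c\<in>C. \<forall>g. cinner (c g) (y k) = 0))"
    and "proj_le (right_support (op_prod (op_star C) Y)) (left_support C) \<longleftrightarrow>
      (\<forall>k. (\<forall>c\<in>C. \<forall>g. cinner (c g) k = 0) \<longrightarrow> (\<forall>y\<in>Y. \<forall>c\<in>C. \<forall>g. cinner (c g) (y k) = 0))"
proof -
  have adj: "\<exists>s\<in>M. is_adjoint y s" if "y \<in> Y" for y using that Y M_adjoint by blast
  have move: "cinner (s (c g)) k = cinner (c g) (y k)" if "is_adjoint y s" for y s c g k
    using is_adjoint_sym[OF that] by (simp add: is_adjoint_def)
  show "op_prod (op_star Y) C \<subseteq> weakstar_right_ideal_generated M C \<longleftrightarrow>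
      (\<forall>k. (\<forall>c\<in>C. \<forall>g. cinner (c g) k = 0) \<longrightarrow> (\<forall>y\<in>Y. \<forall>c\<in>C. \<forall>g. cinner (c g) (y k) = 0))"
  proof
    assume L: "op_prod (op_star Y) C \<subseteq> weakstar_right_ideal_generated M C"
    show "\<forall>k. (\<forall>c\<in>C. \<forall>g. cinner (c g) k = 0) \<longrightarrow> (\<forall>y\<in>Y. \<forall>c\<in>C. \<forall>g. cinner (c g) (y k) = 0)"
    proof (intro allI impI ballI)
      fix k y c g assume k: "\<forall>c\<in>C. \<forall>g. cinner (c g) k = 0" and y: "y \<in> Y" and c: "c \<in> C"
      obtain s where s: "s \<in> M" "is_adjoint y s" using adj[OF y] by blast
      have "s o\<^sub>L c \<in> op_prod (op_star Y) C"
        unfolding op_prod_def op_star_eq[OF Y] using s y c by blast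
      then have "cinner ((s o\<^sub>L c) g) k = 0"
        using L k unfolding weakstar_right_ideal_generated_eq[OF C] by blast
      then show "cinner (c g) (y k) = 0" by (simp add: move[OF s(2)])
    qed
  next
    assume R: "\<forall>k. (\<forall>c\<in>C. \<forall>g. cinner (c g) k = 0) \<longrightarrow> (\<forall>y\<in>Y. \<forall>c\<in>C. \<forall>g. cinner (c g) (y k) = 0)"
    show "op_prod (op_star Y) C \<subseteq> weakstar_right_ideal_generated M C"
    proof
      fix T assume "T \<in> op_prod (op_star Y) C"
      then obtain s y c where s: "s \<in> M" "y \<in> Y" "is_adjoint y s" "c \<in> C" and T: "T = s o\<^sub>L c"
        unfolding op_prod_def op_star_eq[OF Y] by blast
      show "T \<in> weakstar_right_ideal_generated M C"
        unfolding weakstar_right_ideal_generated_eq[OF C] T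
        using R s C M_compose by (auto simp: move[OF s(3)])
    qed
  qed
  have B: "op_prod (op_star C) Y \<subseteq> B_ops"
    using op_star_subset[OF C] Y M_compose M_B_ops unfolding op_prod_def by blast
  have key: "t v = 0 \<longleftrightarrow> (\<forall>g. cinner (c g) v = 0)" if "is_adjoint c t" for c t v
  proof -
    have "cinner (c g) v = cinner g (t v)" for g using that by (simp add: is_adjoint_def)
    then show ?thesis by (simp add: all_cinner_eq_0_iff)
  qed
  have adjC: "\<exists>t\<in>M. is_adjoint c t" if "c \<in> C" for c using that C M_adjoint by blast
  have "(\<forall>T\<in>op_prod (op_star C) Y. T k = 0) \<longleftrightarrow> (\<forall>y\<in>Y. \<forall>c\<in>C. \<forall>g. cinner (c g) (y k) = 0)" for k
  proof
    assume L: "\<forall>T\<in>op_prod (op_star C) Y. T k = 0"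
    show "\<forall>y\<in>Y. \<forall>c\<in>C. \<forall>g. cinner (c g) (y k) = 0"
    proof (intro ballI)
      fix y c assume y: "y \<in> Y" and c: "c \<in> C"
      obtain t where t: "t \<in> M" "is_adjoint c t" using adjC[OF c] by blast
      have "t o\<^sub>L y \<in> op_prod (op_star C) Y"
        unfolding op_prod_def op_star_eq[OF C] using t y c by blast
      then have "(t o\<^sub>L y) k = 0" using L by blast
      then show "\<forall>g. cinner (c g) (y k) = 0" using key[OF t(2)] by simp
    qed
  next
    assume R: "\<forall>y\<in>Y. \<forall>c\<in>C. \<forall>g. cinner (c g) (y k) = 0"
    show "\<forall>T\<in>op_prod (op_star C) Y. T k = 0"
    proof
      fix T assume "T \<in> op_prod (op_star C) Y"
      then obtain t y c where t: "y \<in> Y" "is_adjoint c t" "c \<in> C" and T: "T = t o\<^sub>L y"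
        unfolding op_prod_def op_star_eq[OF C] by blast
      then show "T k = 0" using R key[OF t(2)] by simp
    qed
  qed
  then show "proj_le (right_support (op_prod (op_star C) Y)) (left_support C) \<longleftrightarrow>
      (\<forall>k. (\<forall>c\<in>C. \<forall>g. cinner (c g) k = 0) \<longrightarrow> (\<forall>y\<in>Y. \<forall>c\<in>C. \<forall>g. cinner (c g) (y k) = 0))"
    by (simp add: proj_le_iff_kernel[OF right_support_kernel(1)[OF B] left_support_kernel(1)]
        left_support_kernel(2) right_support_kernel(2)[OF B])
qed

end

section \<open>The algebra generated by the range\<close>

lemma closed_algebra_generated_least:
  assumes "op_subalgebra B" "closed B" "S \<subseteq> B"
  shows "closed_algebra_generated S \<subseteq> B"
  unfolding closed_algebra_generated_def using assms by (intro hull_minimal) auto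


lemma closed_algebra_generated_diff:
  "d \<in> closed_algebra_generated S \<Longrightarrow> s \<in> S \<Longrightarrow> d - s \<in> closed_algebra_generated S"
  unfolding closed_algebra_generated_def hull_def
  by (auto simp: op_subalgebra_def intro!: op_vs.subspace_diff)

lemma closed_algebra_generated_compose:
  "s \<in> S \<Longrightarrow> t \<in> S \<Longrightarrow> s o\<^sub>L t \<in> closed_algebra_generated S"
  unfolding closed_algebra_generated_def hull_def op_subalgebra_def op_prod_def by blast

lemma completely_contractive_imp_contractive:
  assumes cc: "completely_contractive_on A F" and T: "T \<in> A" "norm T \<le> 1"
  shows "norm (F T) \<le> 1"
proof (rule norm_blinfun_bound)
  fix h
  have "mat_contraction 1 (\<lambda>_ _. T)"
    unfolding mat_contraction_def using norm_apply_le_if_norm_le_1[OF T(2)] by (auto intro: power_mono)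
  then have "mat_contraction 1 (\<lambda>_ _. F T)"
    using completely_contractive_on_contraction[OF cc, of 1 "\<lambda>_ _. T"] T(1) by simp
  then have "(norm (F T h))\<^sup>2 \<le> (norm h)\<^sup>2"
    unfolding mat_contraction_def by (auto dest: spec[of _ "\<lambda>_. h"])
  then have "norm (F T h) \<le> norm h" by (rule power2_le_imp_le) simp
  then show "norm (F T h) \<le> 1 * norm h" by simp
qed simp

lemma subalgebra_with_property:
  assumes A: "op_subalgebra A" and "Q 0"
    and "\<And>S T. S \<in> A \<Longrightarrow> T \<in> A \<Longrightarrow> Q S \<Longrightarrow> Q T \<Longrightarrow> Q (S + T)"
    and "\<And>c T. T \<in> A \<Longrightarrow> Q T \<Longrightarrow> Q (op_scale c T)"
    and "\<And>S T. S \<in> A \<Longrightarrow> T \<in> A \<Longrightarrow> Q S \<Longrightarrow> Q T \<Longrightarrow> Q (S o\<^sub>L T)"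
  shows "op_subalgebra {T \<in> A. Q T}"
proof -
  have sub: "op_vs.subspace A" and prod: "op_prod A A \<subseteq> A" and B: "A \<subseteq> B_ops"
    using A by (auto simp: op_subalgebra_def)
  have "op_vs.subspace {T \<in> A. Q T}"
    unfolding op_vs.subspace_def
    using assms op_vs.subspace_0[OF sub] op_vs.subspace_add[OF sub] op_vs.subspace_scale[OF sub]
    by auto
  moreover have "op_prod {T \<in> A. Q T} {T \<in> A. Q T} \<subseteq> {T \<in> A. Q T}"
    using prod assms(5) by (auto simp: op_prod_def)
  ultimately show ?thesis using B by (auto simp: op_subalgebra_def)
qed

context unital_projection
begin

lemma P_contractive:
  assumes cc: "completely_contractive_on A P" and T: "T \<in> A"
  shows "norm (P T) \<le> norm T"
proof (cases "T = 0")
  case False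
  have "norm (P ((1 / norm T) *\<^sub>R T)) \<le> 1"
    using T False by (intro completely_contractive_imp_contractive[OF cc]) (simp_all add: A_scaleR)
  then show ?thesis using T False by (simp add: P_scaleR)
qed (simp add: P_0)

lemma generated_algebra_subset: "closed_algebra_generated (P ` A) \<subseteq> A"
  using subalgebra_A A_closed P_in by (intro closed_algebra_generated_least) auto

text \<open>The elements \<open>d\<close> of \<open>A\<close> for which \<open>d x\<close> stays in the kernel of \<open>P\<close> for every \<open>x\<close> in that kernel form a
closed subalgebra of \<open>A\<close>, which contains the range of \<open>P\<close>.\<close>

lemma generated_algebra_times_kernel:
  assumes cc: "completely_contractive_on A P"
    and d: "d \<in> closed_algebra_generated (P ` A)" and x: "x \<in> A" "P x = 0"
  shows "P (d o\<^sub>L x) = 0"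
proof -
  let ?B = "{d \<in> A. \<forall>x\<in>A. P x = 0 \<longrightarrow> P (d o\<^sub>L x) = 0}"
  have "op_subalgebra ?B"
  proof (rule subalgebra_with_property[OF subalgebra_A])
    show "\<forall>x\<in>A. P x = 0 \<longrightarrow> P (0 o\<^sub>L x) = 0" by (simp add: P_0)
  next
    fix S T assume "S \<in> A" "T \<in> A"
      and "\<forall>x\<in>A. P x = 0 \<longrightarrow> P (S o\<^sub>L x) = 0" "\<forall>x\<in>A. P x = 0 \<longrightarrow> P (T o\<^sub>L x) = 0"
    moreover have e: "(S + T) o\<^sub>L x = (S o\<^sub>L x) + (T o\<^sub>L x)" for x
      by (rule blinfun_eqI) (simp add: blinfun.add_left)
    ultimately show "\<forall>x\<in>A. P x = 0 \<longrightarrow> P ((S + T) o\<^sub>L x) = 0"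
      by (simp add: e P_add A_compose)
  next
    fix c T assume "T \<in> A" and "\<forall>x\<in>A. P x = 0 \<longrightarrow> P (T o\<^sub>L x) = 0"
    moreover have e: "op_scale c T o\<^sub>L x = op_scale c (T o\<^sub>L x)" for x
      by (rule blinfun_eqI) (simp add: op_scale.rep_eq)
    ultimately show "\<forall>x\<in>A. P x = 0 \<longrightarrow> P (op_scale c T o\<^sub>L x) = 0"
      by (simp add: e P_op_scale A_compose)
  next
    fix S T assume "S \<in> A" "T \<in> A"
      and "\<forall>x\<in>A. P x = 0 \<longrightarrow> P (S o\<^sub>L x) = 0" "\<forall>x\<in>A. P x = 0 \<longrightarrow> P (T o\<^sub>L x) = 0"
    moreover have e: "(S o\<^sub>L T) o\<^sub>L x = S o\<^sub>L (T o\<^sub>L x)" for x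
      by (rule blinfun_eqI) simp
    ultimately show "\<forall>x\<in>A. P x = 0 \<longrightarrow> P ((S o\<^sub>L T) o\<^sub>L x) = 0"
      by (simp add: e A_compose)
  qed
  moreover have "closed ?B"
    unfolding closed_sequential_limits
  proof (intro allI impI, elim conjE)
    fix f d assume f: "\<forall>n. f n \<in> ?B" and lim: "f \<longlonglongrightarrow> d"
    then have dA: "d \<in> A" using A_closed unfolding closed_sequential_limits by blast
    have "P (d o\<^sub>L x) = 0" if x: "x \<in> A" "P x = 0" for x
    proof -
      have "norm (P (d o\<^sub>L x)) \<le> norm (d - f n) * norm x" for n
      proof -
        have "d o\<^sub>L x = ((d - f n) o\<^sub>L x) + (f n o\<^sub>L x)"
          by (rule blinfun_eqI) (simp add: blinfun.diff_left blinfun.add_left)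
        then have "P (d o\<^sub>L x) = P ((d - f n) o\<^sub>L x)"
          using f dA x by (simp add: P_add A_compose A_diff)
        also have "norm \<dots> \<le> norm ((d - f n) o\<^sub>L x)"
          using f dA x by (intro P_contractive[OF cc]) (simp add: A_compose A_diff)
        also have "\<dots> \<le> norm (d - f n) * norm x" by (rule norm_blinfun_compose)
        finally show ?thesis .
      qed
      moreover have "(\<lambda>n. norm (d - f n) * norm x) \<longlonglongrightarrow> norm (d - d) * norm x"
        by (intro tendsto_intros lim)
      ultimately have "norm (P (d o\<^sub>L x)) \<le> norm (d - d) * norm x"
        by (intro LIMSEQ_le_const) auto
      then show ?thesis by simp
    qed
    then show "d \<in> ?B" using dA by blast
  qed
  moreover have "P ` A \<subseteq> ?B" using range_times_kernel[OF cc] P_in P_idem by auto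
  ultimately have "closed_algebra_generated (P ` A) \<subseteq> ?B" by (rule closed_algebra_generated_least)
  then show ?thesis using d x by blast
qed

lemma generated_algebra_invariant:
  assumes K: "csubspace K" "closed K"
    and inv: "\<And>y k. y \<in> P ` A \<Longrightarrow> k \<in> K \<Longrightarrow> blinfun_apply y k \<in> K"
    and d: "d \<in> closed_algebra_generated (P ` A)" and k: "k \<in> K"
  shows "blinfun_apply d k \<in> K"
proof -
  let ?B = "{T \<in> A. \<forall>k\<in>K. blinfun_apply T k \<in> K}"
  have "op_subalgebra ?B"
    using K(1) by (intro subalgebra_with_property[OF subalgebra_A])
      (auto simp: csubspace_def blinfun.add_left op_scale.rep_eq)
  moreover have "closed ?B"
  proof -
    have "closed ((\<lambda>T. blinfun_apply T k) -` K)" for k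
      by (intro closed_vimage K(2) continuous_intros)
    then have "closed (A \<inter> (\<Inter>k\<in>K. (\<lambda>T. blinfun_apply T k) -` K))"
      by (intro closed_Int A_closed closed_INT) auto
    moreover have "A \<inter> (\<Inter>k\<in>K. (\<lambda>T. blinfun_apply T k) -` K) = ?B" by auto
    ultimately show ?thesis by simp
  qed
  moreover have "P ` A \<subseteq> ?B" using inv P_in by auto
  ultimately have "closed_algebra_generated (P ` A) \<subseteq> ?B" by (rule closed_algebra_generated_least)
  then show ?thesis using d k by blast
qed

end

theorem theorem4p9:
  fixes M A C D :: "('h::complex_hilbert \<Rightarrow>\<^sub>L 'h) set"
    and P :: "('h \<Rightarrow>\<^sub>L 'h) \<Rightarrow> ('h \<Rightarrow>\<^sub>L 'h)"
  assumes "von_neumann_algebra M"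
    and "unital_operator_algebra A"
    and "A \<subseteq> M"
    and "linear_projection_on A P"
    and "P id_blinfun = id_blinfun"
    and "completely_bicontractive_on A P"
    and "D = closed_algebra_generated (P ` A)"
    and "C = (\<lambda>d. d - P d) ` D"
  shows "(op_prod C (op_star (P ` A)) \<subseteq> weakstar_left_ideal_generated M C \<longleftrightarrow>
            proj_le (left_support (op_prod (P ` A) (op_star C))) (right_support C)) \<and>
         (op_prod (op_star (P ` A)) C \<subseteq> weakstar_right_ideal_generated M C \<longleftrightarrow>
            proj_le (right_support (op_prod (op_star C) (P ` A))) (left_support C)) \<and>
         (op_prod C (op_star (P ` A)) \<subseteq> weakstar_left_ideal_generated M C \<or>
          op_prod (op_star (P ` A)) C \<subseteq> weakstar_right_ideal_generated M C \<longrightarrow>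
            op_subalgebra (P ` A) \<and> P ` A \<subseteq> A)"
proof -
  interpret von_neumann M by unfold_locales (rule assms(1))
  interpret unital_projection A P by unfold_locales (rule assms(2) assms(4) assms(5))+
  have cc: "completely_contractive_on A P" "completely_contractive_on A (\<lambda>T. T - P T)"
    using assms(6) by (auto simp: completely_bicontractive_on_def)
  have YA: "P ` A \<subseteq> A" using P_in by blast
  then have YM: "P ` A \<subseteq> M" using assms(3) by blast
  have DA: "D \<subseteq> A" unfolding assms(7) by (rule generated_algebra_subset)
  have C: "c \<in> D" "c \<in> A" "P c = 0" if c: "c \<in> C" for c
  proof -
    obtain d where d: "d \<in> D" "c = d - P d" using c assms(8) by blast
    then show "c \<in> D"
      using DA unfolding assms(7) by (auto intro!: closed_algebra_generated_diff)
    have "d \<in> A" using d DA by blast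
    then show "c \<in> A" "P c = 0" by (simp_all add: d(2) A_diff P_in P_diff P_idem)
  qed
  then have CM: "C \<subseteq> M" using assms(3) by blast
  have CC: "c (c' h) = 0" if c: "c \<in> C" and c': "c' \<in> C" for c c' h
  proof -
    have "c o\<^sub>L c' = P (c o\<^sub>L c')"
      by (rule kernel_times_kernel[OF cc(2) C(2,3)[OF c] C(2,3)[OF c'], symmetric])
    also have "\<dots> = 0"
      using C[OF c] C[OF c'] unfolding assms(7) by (intro generated_algebra_times_kernel[OF cc(1)])
    finally show ?thesis by (metis blinfun_apply_blinfun_compose zero_blinfun.rep_eq)
  qed
  define K where "K = {k. \<forall>c\<in>C. c k = 0}"
  define R where "R = {k. \<forall>c\<in>C. \<forall>g. cinner (c g) k = 0}"
  have K: "csubspace K" "closed K"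
    unfolding K_def
    using csubspace_INT[of C "\<lambda>c. {k. blinfun_apply c k = 0}"]
      closed_INT_Collect[of C "\<lambda>c. {k. blinfun_apply c k = 0}"]
      right_support_op_kernel(3,4) CM M_B_ops by auto
  have R: "csubspace R" "closed R"
    unfolding R_def
    using csubspace_INT[of C "\<lambda>c. {k. \<forall>g. cinner (blinfun_apply c g) k = 0}"]
      closed_INT_Collect[of C "\<lambda>c. {k. \<forall>g. cinner (blinfun_apply c g) k = 0}"]
      left_support_op_kernel(3,4) by auto
  have subalgebra: "op_subalgebra (P ` A)" if zero: "\<And>c. c \<in> C \<Longrightarrow> c = 0"
  proof -
    have "op_prod (P ` A) (P ` A) \<subseteq> P ` A"
    proof
      fix T assume "T \<in> op_prod (P ` A) (P ` A)"
      then obtain s t where st: "s \<in> P ` A" "t \<in> P ` A" and T: "T = s o\<^sub>L t"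
        by (auto simp: op_prod_def)
      have "T \<in> D" unfolding T assms(7) using st by (rule closed_algebra_generated_compose)
      then have "T - P T = 0" using zero assms(8) by blast
      then show "T \<in> P ` A" using \<open>T \<in> D\<close> DA by (metis image_eqI right_minus_eq subsetD)
    qed
    then show ?thesis
      using subspace_range YM M_B_ops by (auto simp: op_subalgebra_def)
  qed
  \<comment> \<open>The first hypothesis: \<open>D\<close> leaves the orthogonal complement \<open>L\<close> of \<open>K\<close> invariant.\<close>
  have left: "c = 0"
    if H: "\<forall>k. (\<forall>c\<in>C. c k = 0) \<longrightarrow>
        (\<forall>y\<in>P ` A. \<forall>s\<in>M. is_adjoint y s \<longrightarrow> (\<forall>c\<in>C. c (s k) = 0))" and c: "c \<in> C" for c
  proof (rule blinfun_eqI)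
    fix x
    define L where "L = {h. \<forall>k\<in>K. cinner h k = 0}"
    have L: "csubspace L" by (auto simp: L_def csubspace_def cinner_add_left cinner_scaleC_left)
    have "closed {h. cinner h k = 0}" for k :: 'h
      by (intro closed_Collect_eq continuous_intros continuous_on_id
          bounded_linear.continuous_on[OF bounded_linear_cinner_left])
    then have Lcl: "closed L"
      using closed_INT_Collect[of K "\<lambda>k. {h. cinner h k = 0}"] by (simp add: L_def)
    have "y h \<in> L" if y: "y \<in> P ` A" and h: "h \<in> L" for y h
      unfolding L_def
    proof (intro CollectI ballI)
      fix k assume k: "k \<in> K"
      obtain s where s: "s \<in> M" "is_adjoint y s" using M_adjoint y YM by blast
      then have "s k \<in> K" using H k y by (auto simp: K_def)
      then have "cinner h (s k) = 0" using h by (simp add: L_def)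
      then show "cinner (y h) k = 0" using s(2) by (simp add: is_adjoint_def)
    qed
    then have inv: "c h \<in> L" if "h \<in> L" for h
      using generated_algebra_invariant[OF L Lcl, of c h] C(1)[OF c] that unfolding assms(7) by blast
    obtain p where p: "p \<in> K" "\<And>k. k \<in> K \<Longrightarrow> cinner (x - p) k = 0"
      using orthogonal_decomposition_complex[OF K] by blast
    have "c x = c (x - p)" using p(1) c by (simp add: K_def blinfun.diff_right)
    moreover have "c (x - p) \<in> L" using inv p(2) by (simp add: L_def)
    moreover have "c (x - p) \<in> K" using CC[OF _ c] by (simp add: K_def)
    ultimately have "cinner (c x) (c x) = 0" by (simp add: L_def)
    then show "c x = blinfun_apply 0 x" by simp
  qed
  \<comment> \<open>The second hypothesis: \<open>D\<close> leaves \<open>R\<close> invariant, and \<open>C C = 0\<close> makes \<open>C\<close> vanish on the complement of \<open>R\<close>.\<close>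
  have right: "c = 0"
    if H: "\<forall>k. (\<forall>c\<in>C. \<forall>g. cinner (c g) k = 0) \<longrightarrow>
        (\<forall>y\<in>P ` A. \<forall>c\<in>C. \<forall>g. cinner (c g) (y k) = 0)" and c: "c \<in> C" for c
  proof (rule blinfun_eqI)
    fix x
    have inv: "c h \<in> R" if "h \<in> R" for h
      using generated_algebra_invariant[OF R, of c h] C(1)[OF c] that H
      unfolding assms(7) R_def by blast
    obtain r where r: "r \<in> R" "\<And>k. k \<in> R \<Longrightarrow> cinner (x - r) k = 0"
      using orthogonal_decomposition_complex[OF R] by blast
    have "cinner (c r) (c r) = 0" using inv[OF r(1)] c by (simp add: R_def)
    then have cr: "c r = 0" by simp
    obtain t where t: "is_adjoint c t" using M_adjoint c CM by blast
    have "t g \<in> R" for g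
      unfolding R_def
    proof (intro CollectI ballI allI)
      fix c' h assume c': "c' \<in> C"
      have "cinner (c' h) (t g) = cinner (c (c' h)) g" using t by (simp add: is_adjoint_def)
      then show "cinner (c' h) (t g) = 0" by (simp add: CC[OF c c'])
    qed
    then have "cinner (c (x - r)) g = 0" for g using r(2) t by (simp add: is_adjoint_def)
    then have "c (x - r) = 0" by (rule eq_0_if_orthogonal)
    then show "c x = blinfun_apply 0 x" using cr by (simp add: blinfun.diff_right)
  qed
  show ?thesis
    unfolding left_condition_iff[OF CM YM] right_condition_iff[OF CM YM]
    using subalgebra left right YA by blast
qed

end
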